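(* (i) The function $f\mapsto\mathcal T_f$ is an order-isomorphism from $\mathfrak W$ to the subposet of $\mathfrak P$ consisting of the topologies which contain $\mathcal I_2$ and are contained in $\mathcal I_4$. (ii) The function $f\mapsto\mathcal T_f^{-1}$ is an order-isomorphism from $\mathfrak W$ to the subposet of $\mathfrak P$ consisting of the topologies which contain $\mathcal I_3$ and are contained in $\mathcal I_4$.
   Context: $\mathbb N=\omega=\{0,1,2,\dots\}$; $\omega+1=\omega\cup\{\omega\}$ with $\omega$ the largest element. Functions are written on the right of their arguments. $I_{\mathbb N}$ is the symmetric inverse monoid: all bijections between subsets of $\mathbb N$ (including the empty map), viewed as subsets of $\mathbb N\times\mathbb N$, with multiplication the composition of binary relations ($fg$ means first $f$, then $g$). A Polish semigroup topology on $I_{\mathbb N}$ is a Polish topology for which multiplication is (jointly) continuous. $\mathfrak P$ is the poset of all Polish semigroup topologies on $I_{\mathbb N}$, ordered by containment. For a topology $\mathcal T$ on $I_{\mathbb N}$, $\mathcal T^{-1}=\{U^{-1}:U\in\mathcal T\}$, where $U^{-1}=\{g^{-1}:g\in U\}$. For $x,y\in\mathbb N$ let $U_{x,y}=\{h\in I_{\mathbb N}:(x,y)\in h\}$, $W_x=\{h\in I_{\mathbb N}:x\notin\operatorname{dom}(h)\}$, $W_x^{-1}=\{h\in I_{\mathbb N}:x\notin\operatorname{im}(h)\}$. $\mathcal I_2$ is the topology with subbasis $\{U_{x,y}:x,y\in\mathbb N\}\cup\{W_x:x\in\mathbb N\}$; $\mathcal I_3$ is the topology with subbasis $\{U_{x,y}:x,y\in\mathbb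 N\}\cup\{W_x^{-1}:x\in\mathbb N\}$; $\mathcal I_4$ is the topology generated by $\mathcal I_2\cup\mathcal I_3$. For any function $f:\omega+1\to\omega+1$, $\mathcal T_f$ is the least topology on $I_{\mathbb N}$ containing $\mathcal I_2$ and all sets $$U_{f,n,X}=\{g\in I_{\mathbb N}: |\operatorname{im}(g)\setminus X|\ge n \text{ and } |X\cap\operatorname{im}(g)|\le (n)f\},$$ where $n\in\mathbb N$ and $X\subset\mathbb N$ is finite. A non-increasing function $f:\omega+1\to\omega+1$ is waning if either $f$ is constant with value $\omega$, or there exists $i\in\omega$ with $(i)f\in\omega$, and $(j+1)f<(j)f$ for all $j\in\omega$ such that $0\ne(j)f\in\omega$. $\mathfrak W$ is the set of all waning functions with the partial order $\preceq$ given by: $f\preceq g$ if and only if $(i)f\ge(i)g$ for all $i\in\omega+1$. *)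

theory Defs
  imports "HOL-Analysis.Analysis" "HOL-Library.Extended_Nat"
begin

text \<open>
  Partial bijections of \<open>\<nat>\<close> are represented by their graphs.  Since \<open>f O g\<close> is
  ``first \<open>f\<close>, then \<open>g\<close>'', relational composition is the right-action
  product \<open>fg\<close>, \<open>converse\<close> is inversion, and \<open>Range\<close> is the image.
  The ordinal \<open>\<omega> + 1\<close> is the type \<^typ>\<open>enat\<close>, with \<open>\<infinity>\<close> playing the role of \<open>\<omega>\<close>.
\<close>

definition sym_inv_monoid :: "nat rel set" where
  "sym_inv_monoid = {f. single_valued f \<and> single_valued (f\<inverse>)}"


subsection \<open>Polish semigroup topologies\<close>

definition separable_space :: "'a topology \<Rightarrow> bool" where
  "separable_space T \<longleftrightarrow> (\<exists>C. countable C \<and> C \<subseteq> topspace T \<and> T closure_of C = topspace T)"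

definition Polish_space :: "'a topology \<Rightarrow> bool" where
  "Polish_space T \<longleftrightarrow> separable_space T \<and> completely_metrizable_space T"

definition semigroup_topology :: "nat rel topology \<Rightarrow> bool" where
  "semigroup_topology T \<longleftrightarrow>
     topspace T = sym_inv_monoid \<and>
     continuous_map (prod_topology T T) T (\<lambda>(f, g). f O g)"

definition Polish_semigroup_topologies :: "nat rel topology set" where
  "Polish_semigroup_topologies = {T. Polish_space T \<and> semigroup_topology T}"

definition topology_le :: "'a topology \<Rightarrow> 'a topology \<Rightarrow> bool" where
  "topology_le S T \<longleftrightarrow> Collect (openin S) \<subseteq> Collect (openin T)"

definition inverse_topology :: "('a \<times> 'a) set topology \<Rightarrow> ('a \<times> 'a) set topology" where
  "inverse_topology T = topology (\<lambda>V. V \<in> {converse ` U | U. openin T U})"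

text \<open>The collection in the definition above really is a topology.\<close>

lemma openin_inverse_topology:
  "openin (inverse_topology T) V \<longleftrightarrow> (\<exists>U. openin T U \<and> V = converse ` U)"
proof -
  have eq: "(\<exists>U. openin T U \<and> V = converse ` U) \<longleftrightarrow> openin T (converse ` V)" for V
    by (metis (no_types, lifting) converse_converse image_ident image_image image_cong)
  have inj: "inj (converse :: ('a \<times> 'a) set \<Rightarrow> _)"
    by (rule injI) simp
  have "istopology (\<lambda>V. openin T (converse ` V))"
    unfolding istopology_def
    by (auto simp: image_Int[OF inj] image_Union intro: openin_Int openin_Union)
  moreover have "inverse_topology T = topology (\<lambda>V. openin T (converse ` V))"
    unfolding inverse_topology_def using eq by (intro arg_cong[where f = topology] ext) blast
  ultimately show ?thesis
    using eq by (simp add: topology_inverse')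
qed


subsection \<open>The topologies \<open>\<I>\<^sub>2\<close>, \<open>\<I>\<^sub>3\<close> and \<open>\<I>\<^sub>4\<close>\<close>

definition U_set :: "nat \<Rightarrow> nat \<Rightarrow> nat rel set" where
  "U_set x y = {h \<in> sym_inv_monoid. (x, y) \<in> h}"

definition W_set :: "nat \<Rightarrow> nat rel set" where
  "W_set x = {h \<in> sym_inv_monoid. x \<notin> Domain h}"

definition W_inv_set :: "nat \<Rightarrow> nat rel set" where
  "W_inv_set x = {h \<in> sym_inv_monoid. x \<notin> Range h}"

definition I2 :: "nat rel topology" where
  "I2 = topology_generated_by ({U_set x y | x y. True} \<union> {W_set x | x. True})"

definition I3 :: "nat rel topology" where
  "I3 = topology_generated_by ({U_set x y | x y. True} \<union> {W_inv_set x | x. True})"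

definition I4 :: "nat rel topology" where
  "I4 = topology_generated_by (Collect (openin I2) \<union> Collect (openin I3))"

text \<open>
  The space of a generated topology is the union of the generating sets, so it has to
  be checked that these cover the monoid.
\<close>

lemma topspace_I2: "topspace I2 = sym_inv_monoid"
proof -
  have "(\<exists>x y. h \<in> U_set x y) \<or> (\<exists>x. h \<in> W_set x)" if "h \<in> sym_inv_monoid" for h
  proof (cases "0 \<in> Domain h")
    case True
    then obtain y where "(0, y) \<in> h"
      by blast
    with that have "h \<in> U_set 0 y"
      by (simp add: U_set_def)
    then show ?thesis
      by blast
  next
    case False
    with that have "h \<in> W_set 0"
      by (simp add: W_set_def)
    then show ?thesis
      by blast
  qed
  moreover have "U_set x y \<subseteq> sym_inv_monoid" "W_set x \<subseteq> sym_inv_monoid" for x y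
    by (auto simp: U_set_def W_set_def)
  moreover have "topspace I2 = (\<Union>x. \<Union>y. U_set x y) \<union> (\<Union>x. W_set x)"
    unfolding I2_def topology_generated_by_topspace by blast
  ultimately show ?thesis
    by (simp add: set_eq_iff subset_iff) metis
qed

lemma topspace_I3: "topspace I3 = sym_inv_monoid"
proof -
  have "(\<exists>x y. h \<in> U_set x y) \<or> (\<exists>x. h \<in> W_inv_set x)" if "h \<in> sym_inv_monoid" for h
  proof (cases "0 \<in> Range h")
    case True
    then obtain y where "(y, 0) \<in> h"
      by blast
    with that have "h \<in> U_set y 0"
      by (simp add: U_set_def)
    then show ?thesis
      by blast
  next
    case False
    with that have "h \<in> W_inv_set 0"
      by (simp add: W_inv_set_def)
    then show ?thesis
      by blast
  qed
  moreover have "U_set x y \<subseteq> sym_inv_monoid" "W_inv_set x \<subseteq> sym_inv_monoid" for x y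
    by (auto simp: U_set_def W_inv_set_def)
  moreover have "topspace I3 = (\<Union>x. \<Union>y. U_set x y) \<union> (\<Union>x. W_inv_set x)"
    unfolding I3_def topology_generated_by_topspace by blast
  ultimately show ?thesis
    by (simp add: set_eq_iff subset_iff) metis
qed

lemma topspace_I4: "topspace I4 = sym_inv_monoid"
proof -
  have "\<Union> (Collect (openin I2) \<union> Collect (openin I3)) = topspace I2 \<union> topspace I3"
    by (auto simp: topspace_def)
  then show ?thesis
    by (simp add: I4_def topspace_I2 topspace_I3)
qed


subsection \<open>The topologies \<open>\<T>\<^sub>f\<close>\<close>

text \<open>Cardinality in \<open>\<omega> + 1\<close>; \<^const>\<open>card\<close> would send infinite sets to \<open>0\<close>.\<close>

definition ecard :: "'a set \<Rightarrow> enat" where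
  "ecard A = (if finite A then enat (card A) else \<infinity>)"

definition U_fun_set :: "(enat \<Rightarrow> enat) \<Rightarrow> nat \<Rightarrow> nat set \<Rightarrow> nat rel set" where
  "U_fun_set f n X =
     {g \<in> sym_inv_monoid. ecard (Range g - X) \<ge> enat n \<and> ecard (X \<inter> Range g) \<le> f (enat n)}"

definition T_fun :: "(enat \<Rightarrow> enat) \<Rightarrow> nat rel topology" where
  "T_fun f = topology_generated_by (Collect (openin I2) \<union> {U_fun_set f n X | n X. finite X})"

lemma topspace_T_fun: "topspace (T_fun f) = sym_inv_monoid"
proof -
  have "\<Union> (Collect (openin I2) \<union> {U_fun_set f n X | n X. finite X}) =
        topspace I2 \<union> \<Union> {U_fun_set f n X | n X. finite X}"
    by (auto simp: topspace_def)
  then show ?thesis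
    by (auto simp: T_fun_def topspace_I2 U_fun_set_def)
qed


subsection \<open>Waning functions\<close>

definition waning :: "(enat \<Rightarrow> enat) \<Rightarrow> bool" where
  "waning f \<longleftrightarrow> antimono f \<and>
     ((\<forall>i. f i = \<infinity>) \<or>
      ((\<exists>i::nat. f (enat i) \<noteq> \<infinity>) \<and>
       (\<forall>j::nat. f (enat j) \<noteq> 0 \<and> f (enat j) \<noteq> \<infinity> \<longrightarrow> f (enat (j + 1)) < f (enat j))))"

text \<open>The order on waning functions is the reverse of the pointwise one.\<close>

definition waning_le :: "(enat \<Rightarrow> enat) \<Rightarrow> (enat \<Rightarrow> enat) \<Rightarrow> bool" where
  "waning_le f g \<longleftrightarrow> (\<forall>i. f i \<ge> g i)"


definition order_isomorphism ::
  "'a set \<Rightarrow> ('a \<Rightarrow> 'a \<Rightarrow> bool) \<Rightarrow> 'b set \<Rightarrow> ('b \<Rightarrow> 'b \<Rightarrow> bool) \<Rightarrow> ('a \<Rightarrow> 'b) \<Rightarrow> bool" where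
  "order_isomorphism A le B le' \<phi> \<longleftrightarrow>
     bij_betw \<phi> A B \<and> (\<forall>x\<in>A. \<forall>y\<in>A. le x y \<longleftrightarrow> le' (\<phi> x) (\<phi> y))"

end

theory Submission
  imports Defs
begin

text \<open>
  The topology \<^term>\<open>T_fun f\<close> restricts how many new points may enter the image of a partial
  bijection under a small perturbation: a neighbour of \<open>h\<close> has, in a given finite set, at most \<open>f r\<close>
  image points that \<open>h\<close> does not have, where \<open>r\<close> is the rank of \<open>h\<close>
  (\<open>openin_T_fun_neighbourhood_finite_rank\<close>).  The value \<open>f r = \<infinity>\<close> means that there is no restriction, as
  in \<open>\<I>\<^sub>2\<close>, and \<open>f r = 0\<close> that there are no new points, as in \<open>\<I>\<^sub>4\<close>.  Waning is what consistency
  requires: a neighbour of \<open>h\<close> with one new image point has larger rank, and can have at most \<open>f r - 1\<close>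
  further new points.

  \<^emph>\<open>These topologies are Polish.\<close>  The set \<^term>\<open>U_fun_set f n X\<close> is the union of sets that are open
  in \<^term>\<open>T_fun f\<close> and closed for pointwise convergence of characteristic functions, which is a compact
  metrizable topology; \<open>\<I>\<^sub>2\<close> itself arises by declaring the closed sets \<^term>\<open>W_set x\<close> open.
  Adding countably many closed sets
  to a completely metrizable topology leaves it completely metrizable
  (\<open>completely_metrizable_space_add_closed_sets\<close>).  Multiplication is continuous because a waning \<open>f\<close>
  satisfies \<open>f (n + c) \<le> f n - c\<close> (\<open>waning_drop\<close>): a factor whose image has more than \<open>f n\<close> points in \<open>X\<close>
  admits no new ones (\<open>T_fun_mult_neighbourhoods\<close>).

  \<^emph>\<open>The order is reflected.\<close>  The values of \<open>f\<close> can be read off from the neighbourhoods of partial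
  bijections of finite rank (\<open>T_fun_le_iff\<close>).

  \<^emph>\<open>There are no other topologies.\<close>  Let \<open>T\<close> be a Polish semigroup topology between \<open>\<I>\<^sub>2\<close> and \<open>\<I>\<^sub>4\<close>.  Say that
  \<open>h\<close> evades \<open>Z\<close> if some neighbourhood of \<open>h\<close> has no element with \<open>Z\<close> in its image.  By
  multiplying with suitable partial bijections one sees that for finite \<open>h\<close> and \<open>Z\<close> disjoint from the image of \<open>h\<close> this depends only on
  the rank of \<open>h\<close> and the size of \<open>Z\<close> (\<open>evades_transfer\<close>); let \<open>f r\<close> be the
  largest size of a set that is not evaded at rank \<open>r\<close>, or \<open>\<infinity>\<close> if there are arbitrarily large ones.
  Two arguments with products show that evasion determines \<open>T\<close>.  A set evaded by a restriction of \<open>h\<close> is evaded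
  by \<open>h\<close> (\<open>evades_extension\<close>), so that \<open>f\<close> is non-increasing and \<open>T\<close> contains \<^term>\<open>T_fun f\<close>.  Conversely, if
  there are neighbours of \<open>h\<close> with certain new points in the image, then there are as many neighbours as
  this permits (\<open>neighbourhood_of_few_new_image_points\<close>), because such a neighbour can be modified
  at will by factors close to idempotents.  This gives strict descent of \<open>f\<close> and the inclusion of \<open>T\<close> in
  \<^term>\<open>T_fun f\<close>.  Finite partial bijections are dealt with first; since \<open>T\<close> is regular, infinite
  ones follow as limits of finite ones.

  The second isomorphism follows by inversion, which exchanges \<open>\<I>\<^sub>2\<close> with \<open>\<I>\<^sub>3\<close> and fixes \<open>\<I>\<^sub>4\<close>.
\<close>


section \<open>Comparing topologies through generators\<close>

lemma topology_le_iff: "topology_le S T \<longleftrightarrow> (\<forall>U. openin S U \<longrightarrow> openin T U)"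
  by (auto simp: topology_le_def)

lemma topology_le_antisym: "topology_le S T \<Longrightarrow> topology_le T S \<Longrightarrow> S = T"
  by (auto simp: topology_le_iff topology_eq)

lemma topology_generated_by_le:
  assumes "\<And>S. S \<in> \<S> \<Longrightarrow> openin T S"
  shows "topology_le (topology_generated_by \<S>) T"
  unfolding topology_le_iff openin_topology_generated_by_iff
proof (intro allI impI)
  fix U assume "generate_topology_on \<S> U"
  then show "openin T U"
    by induction (use assms in auto)
qed

lemma topology_le_generated_by:
  assumes "Collect (openin S) \<subseteq> \<S>"
  shows "topology_le S (topology_generated_by \<S>)"
  unfolding topology_le_iff using assms by (auto intro: topology_generated_by_Basis)


section \<open>Adding countably many closed sets to a completely metrizable topology\<close>

lemma continuous_map_bool_iff:
  "continuous_map X (discrete_topology UNIV) P \<longleftrightarrow>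
     openin X {x \<in> topspace X. P x} \<and> openin X {x \<in> topspace X. \<not> P x}"
proof
  assume cont: "continuous_map X (discrete_topology UNIV) P"
  show "openin X {x \<in> topspace X. P x} \<and> openin X {x \<in> topspace X. \<not> P x}"
    using openin_continuous_map_preimage[OF cont, of "{True}"]
      openin_continuous_map_preimage[OF cont, of "{False}"] by simp
next
  assume op: "openin X {x \<in> topspace X. P x} \<and> openin X {x \<in> topspace X. \<not> P x}"
  have "P x \<in> V \<longleftrightarrow> (P x \<and> True \<in> V) \<or> (\<not> P x \<and> False \<in> V)" for x V
    by (cases "P x") auto
  then have "{x \<in> topspace X. P x \<in> V} = (if True \<in> V then {x \<in> topspace X. P x} else {}) \<union>
      (if False \<in> V then {x \<in> topspace X. \<not> P x} else {})" for V
    by auto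
  moreover have "openin X (if True \<in> V then {x \<in> topspace X. P x} else {})"
    "openin X (if False \<in> V then {x \<in> topspace X. \<not> P x} else {})" for V
    using op by auto
  ultimately show "continuous_map X (discrete_topology UNIV) P"
    by (simp add: continuous_map_def openin_Un)
qed

lemma completely_metrizable_space_power_bool:
  assumes "countable I"
  shows "completely_metrizable_space (product_topology (\<lambda>_. discrete_topology (UNIV :: bool set)) I)"
  unfolding completely_metrizable_space_product_topology
  by (intro disjI2 conjI ballI countable_subset[OF _ assms])
     (auto simp: completely_metrizable_space_discrete_topology)

text \<open>
  A point together with the list of the closed sets to which it belongs determines a copy of the
  refined space inside the product of the old space with a countable power of the two point
  space.  Membership of a pair in this copy is a countable conjunction of conditions, each of which
  holds on the union of a closed set and an open set; the copy is thus a \<open>G\<^sub>\<delta>\<close> set.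
\<close>

lemma completely_metrizable_space_add_closed_sets:
  assumes X: "completely_metrizable_space X"
    and count: "countable \<F>" and closed: "\<And>F. F \<in> \<F> \<Longrightarrow> closedin X F"
  shows "completely_metrizable_space (topology_generated_by (Collect (openin X) \<union> \<F>))"
proof -
  define R where "R = topology_generated_by (Collect (openin X) \<union> \<F>)"
  define B where "B = product_topology (\<lambda>_. discrete_topology (UNIV :: bool set)) \<F>"
  define P where "P = prod_topology X B"
  define \<phi> where "\<phi> x = (x, restrict (\<lambda>F. x \<in> F) \<F>)" for x :: 'a
  define C where "C F = {z \<in> topspace P. fst z \<in> F \<longleftrightarrow> snd z F}" for F
  define S where "S = {z \<in> topspace P. \<forall>F\<in>\<F>. fst z \<in> F \<longleftrightarrow> snd z F}"
  have B: "completely_metrizable_space B"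
    unfolding B_def by (rule completely_metrizable_space_power_bool[OF count])
  have P: "completely_metrizable_space P"
    unfolding P_def using X B by (simp add: completely_metrizable_space_prod_topology)
  have topX: "F \<subseteq> topspace X" if "F \<in> \<F>" for F
    using closedin_subset[OF closed[OF that]] .
  have topR: "topspace R = topspace X"
    unfolding R_def topology_generated_by_topspace using topX by (auto simp: topspace_def)
  have topP: "topspace P = topspace X \<times> (\<F> \<rightarrow>\<^sub>E UNIV)"
    by (simp add: P_def B_def)
  have cfst: "continuous_map P X fst"
    unfolding P_def by (rule continuous_map_fst)
  have ceval: "continuous_map P (discrete_topology UNIV) (\<lambda>z. snd z F)" if "F \<in> \<F>" for F
    unfolding P_def B_def
    using continuous_map_compose[OF continuous_map_snd continuous_map_product_projection[OF that]]
    by (simp add: o_def)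
  have gd: "gdelta_in P (C F)" if F: "F \<in> \<F>" for F
  proof -
    have eq: "C F = ({z \<in> topspace P. fst z \<in> F} \<inter> {z \<in> topspace P. snd z F \<in> {True}})
      \<union> ({z \<in> topspace P. fst z \<in> topspace X - F} \<inter> {z \<in> topspace P. snd z F \<in> {False}})"
      by (auto simp: C_def topP)
    have cl1: "closedin P {z \<in> topspace P. fst z \<in> F}"
      by (rule closedin_continuous_map_preimage[OF cfst closed[OF F]])
    have cl2: "closedin P {z \<in> topspace P. snd z F \<in> {True}}"
      by (rule closedin_continuous_map_preimage[OF ceval[OF F]]) simp
    have op1: "openin P {z \<in> topspace P. fst z \<in> topspace X - F}"
      using closed[OF F] by (intro openin_continuous_map_preimage[OF cfst]) auto
    have op2: "openin P {z \<in> topspace P. snd z F \<in> {False}}"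
      by (rule openin_continuous_map_preimage[OF ceval[OF F]]) simp
    show ?thesis
      unfolding eq
      by (intro gdelta_in_Un closed_imp_gdelta_in open_imp_gdelta_in
          completely_metrizable_imp_metrizable_space P closedin_Int openin_Int cl1 cl2 op1 op2)
  qed
  have "S = topspace P \<inter> \<Inter> (insert (topspace P) (C ` \<F>))"
    by (auto simp: S_def C_def)
  moreover have "gdelta_in P (topspace P \<inter> \<Inter> (insert (topspace P) (C ` \<F>)))"
    using gd count by (intro gdelta_in_Int gdelta_in_topspace gdelta_in_Inter) auto
  ultimately have "gdelta_in P S"
    by simp
  with P have PS: "completely_metrizable_space (subtopology P S)"
    by (rule completely_metrizable_space_gdelta_in)
  have "homeomorphic_maps R (subtopology P S) \<phi> fst"
    unfolding homeomorphic_maps_def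
  proof (intro conjI ballI)
    have le: "openin R U" if "openin X U \<or> U \<in> \<F>" for U
      unfolding R_def using that by (intro topology_generated_by_Basis) auto
    have "{x \<in> topspace X. x \<in> U} = U" if "openin X U" for U
      using openin_subset[OF that] by auto
    then have c1: "continuous_map R X (\<lambda>x. x)"
      using le by (simp add: continuous_map_def topR)
    have c2: "continuous_map R (discrete_topology UNIV) (\<lambda>x. x \<in> F)" if F: "F \<in> \<F>" for F
    proof -
      have "openin R F" "openin R (topspace X - F)"
        using le F closed[OF F] by blast+
      moreover have "{x \<in> topspace X. x \<in> F} = F" "{x \<in> topspace X. x \<notin> F} = topspace X - F"
        using topX[OF F] by auto
      ultimately show ?thesis
        by (simp add: continuous_map_bool_iff topR)
    qed
    have "continuous_map R P \<phi>"
      unfolding \<phi>_def P_def B_def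
      by (intro continuous_map_pairedI c1) (auto simp: continuous_map_componentwise intro: c2)
    moreover have "\<phi> \<in> topspace R \<rightarrow> S"
      by (auto simp: \<phi>_def S_def topP topR)
    ultimately show "continuous_map R (subtopology P S) \<phi>"
      by (simp add: continuous_map_in_subtopology image_subset_iff_funcset)
  next
    have SP: "S \<subseteq> topspace P"
      by (auto simp: S_def)
    have tS: "topspace (subtopology P S) = S"
      using SP by auto
    show "continuous_map (subtopology P S) R fst"
      unfolding R_def
    proof (rule continuous_on_generated_topo)
      fix U assume "U \<in> Collect (openin X) \<union> \<F>"
      then consider "openin X U" | "U \<in> \<F>"
        by blast
      then show "openin (subtopology P S) (fst -` U \<inter> topspace (subtopology P S))"
      proof cases
        case 1
        have "openin P {z \<in> topspace P. fst z \<in> U}"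
          using 1 cfst by (rule openin_continuous_map_preimage[rotated])
        moreover have "fst -` U \<inter> topspace (subtopology P S) = {z \<in> topspace P. fst z \<in> U} \<inter> S"
          using SP by (auto simp: tS)
        ultimately show ?thesis
          by (auto simp: openin_subtopology)
      next
        case 2
        have "openin P {z \<in> topspace P. snd z U \<in> {True}}"
          by (rule openin_continuous_map_preimage[OF ceval[OF 2]]) simp
        moreover have "fst -` U \<inter> topspace (subtopology P S)
            = {z \<in> topspace P. snd z U \<in> {True}} \<inter> S"
          using 2 by (auto simp: tS S_def)
        ultimately show ?thesis
          by (auto simp: openin_subtopology)
      qed
    next
      have "fst z \<in> topspace X" if "z \<in> S" for z
        using that by (auto simp: S_def topP)
      moreover have "\<Union> (Collect (openin X) \<union> \<F>) = topspace X"
        using topR by (simp add: R_def)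
      ultimately show "fst ` topspace (subtopology P S) \<subseteq> \<Union> (Collect (openin X) \<union> \<F>)"
        by (auto simp: tS)
    qed
  next
    fix x assume "x \<in> topspace R"
    then show "fst (\<phi> x) = x"
      by (simp add: \<phi>_def)
  next
    fix z assume "z \<in> topspace (subtopology P S)"
    then show "\<phi> (fst z) = z"
      by (cases z) (auto simp: \<phi>_def S_def topP PiE_def extensional_def restrict_def fun_eq_iff)
  qed
  then have "R homeomorphic_space subtopology P S"
    unfolding homeomorphic_space_def by blast
  with PS show ?thesis
    unfolding R_def[symmetric] by (simp add: homeomorphic_completely_metrizable_space)
qed


section \<open>Partial bijections and neighbourhoods of them\<close>

lemma sym_inv_monoid_iff:
  "f \<in> sym_inv_monoid \<longleftrightarrow> (\<forall>x y z. (x, y) \<in> f \<longrightarrow> (x, z) \<in> f \<longrightarrow> y = z) \<and>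
     (\<forall>x y z. (x, z) \<in> f \<longrightarrow> (y, z) \<in> f \<longrightarrow> x = y)"
  by (auto simp: sym_inv_monoid_def single_valued_def)

lemma sym_inv_monoid_right_unique:
  "f \<in> sym_inv_monoid \<Longrightarrow> (x, y) \<in> f \<Longrightarrow> (x, z) \<in> f \<Longrightarrow> y = z"
  unfolding sym_inv_monoid_iff by blast

lemma sym_inv_monoid_left_unique:
  "f \<in> sym_inv_monoid \<Longrightarrow> (x, z) \<in> f \<Longrightarrow> (y, z) \<in> f \<Longrightarrow> x = y"
  unfolding sym_inv_monoid_iff by blast

lemma sym_inv_monoid_relcomp:
  "f \<in> sym_inv_monoid \<Longrightarrow> g \<in> sym_inv_monoid \<Longrightarrow> f O g \<in> sym_inv_monoid"
  unfolding sym_inv_monoid_def by (simp add: converse_relcomp single_valued_relcomp)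

lemma sym_inv_monoid_converse: "f \<in> sym_inv_monoid \<Longrightarrow> f\<inverse> \<in> sym_inv_monoid"
  by (simp add: sym_inv_monoid_def)

lemma sym_inv_monoid_subset: "g \<in> sym_inv_monoid \<Longrightarrow> f \<subseteq> g \<Longrightarrow> f \<in> sym_inv_monoid"
  unfolding sym_inv_monoid_def using single_valued_subset[of f g] single_valued_subset[of "f\<inverse>" "g\<inverse>"]
  by (simp add: converse_mono)

lemma sym_inv_monoid_Id_on: "Id_on A \<in> sym_inv_monoid"
  by (auto simp: sym_inv_monoid_iff)

lemma single_valued_Un:
  assumes "single_valued f" "single_valued g" "Domain f \<inter> Domain g = {}"
  shows "single_valued (f \<union> g)"
proof (rule single_valuedI)
  fix x y z
  assume "(x, y) \<in> f \<union> g" "(x, z) \<in> f \<union> g"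
  moreover have "\<not> ((x, a) \<in> f \<and> (x, b) \<in> g)" for a b
    using assms(3) by (meson DomainI disjoint_iff)
  ultimately show "y = z"
    using assms(1,2) by (metis Un_iff single_valuedD)
qed

lemma sym_inv_monoid_Un:
  assumes "f \<in> sym_inv_monoid" "g \<in> sym_inv_monoid"
    and "Domain f \<inter> Domain g = {}" "Range f \<inter> Range g = {}"
  shows "f \<union> g \<in> sym_inv_monoid"
  using assms by (simp add: sym_inv_monoid_def converse_Un single_valued_Un)

lemma sym_inv_monoid_pairs:
  "inj_on a A \<Longrightarrow> inj_on b A \<Longrightarrow> (\<lambda>z. (a z, b z)) ` A \<in> sym_inv_monoid"
  by (auto simp: sym_inv_monoid_iff inj_on_def)

lemma Domain_graph: "Domain ((\<lambda>x. (x, \<phi> x)) ` A) = A"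
  by (auto simp: Domain_iff)

lemma Range_graph: "Range ((\<lambda>x. (x, \<phi> x)) ` A) = \<phi> ` A"
  by (auto simp: Range_iff)

lemma finite_partial_bijection_iff:
  assumes "h \<in> sym_inv_monoid"
  shows "finite h \<longleftrightarrow> finite (Range h)"
proof
  assume "finite (Range h)"
  moreover have "inj_on snd h"
    by (auto simp: inj_on_def intro: sym_inv_monoid_left_unique[OF assms])
  ultimately show "finite h"
    by (metis finite_imageD Range_snd)
qed (simp add: finite_Range)

lemma exists_restriction_with_range:
  assumes "h \<in> sym_inv_monoid" "S \<subseteq> Range h" "finite S"
  shows "\<exists>p \<subseteq> h. finite p \<and> Range p = S"
proof -
  let ?p = "{(x, y). (x, y) \<in> h \<and> y \<in> S}"
  have "Range ?p = S"
    using assms(2) by auto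
  moreover have "finite ?p"
  proof -
    have "?p \<in> sym_inv_monoid"
      by (rule sym_inv_monoid_subset[OF assms(1)]) auto
    then show ?thesis
      using assms(3) \<open>Range ?p = S\<close> by (simp add: finite_partial_bijection_iff)
  qed
  moreover have "?p \<subseteq> h"
    by auto
  ultimately show ?thesis
    by (intro exI[of _ ?p]) simp
qed

text \<open>
  For finite \<open>Y\<close> the partial bijections that agree with \<open>h\<close> at the points of \<open>Y\<close>, which includes
  being undefined at the same points, form basic neighbourhoods of \<open>h\<close> in \<open>\<I>\<^sub>2\<close>; agreement of the
  inverses gives \<open>\<I>\<^sub>3\<close>, and both together give \<open>\<I>\<^sub>4\<close>.
\<close>

definition dom_agree :: "nat set \<Rightarrow> nat rel \<Rightarrow> nat rel \<Rightarrow> bool" where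
  "dom_agree Y g h \<longleftrightarrow> (\<forall>x\<in>Y. \<forall>y. (x, y) \<in> g \<longleftrightarrow> (x, y) \<in> h)"

definition im_agree :: "nat set \<Rightarrow> nat rel \<Rightarrow> nat rel \<Rightarrow> bool" where
  "im_agree Y g h \<longleftrightarrow> (\<forall>y\<in>Y. \<forall>x. (x, y) \<in> g \<longleftrightarrow> (x, y) \<in> h)"

lemma dom_agree_refl: "dom_agree Y h h"
  by (simp add: dom_agree_def)

text \<open>
  The relation \<open>A Y g\<close> stands for closeness of \<open>g\<close> to \<open>h\<close> as measured by the finite set \<open>Y\<close>.  It is kept
  abstract, since besides agreement with \<open>h\<close> it may carry a restriction on the image of \<open>g\<close> that does
  not vary with \<open>Y\<close>.
\<close>

lemma generated_neighbourhood:
  assumes "generate_topology_on \<S> U" "h \<in> U"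
    and "\<And>S. S \<in> \<S> \<Longrightarrow> h \<in> S \<Longrightarrow> \<exists>Y. finite Y \<and> (\<forall>g\<in>sym_inv_monoid. A Y g \<longrightarrow> g \<in> S)"
    and anti: "\<And>Y Y' g. Y' \<subseteq> Y \<Longrightarrow> A Y g \<Longrightarrow> A Y' g"
  shows "\<exists>Y. finite Y \<and> (\<forall>g\<in>sym_inv_monoid. A Y g \<longrightarrow> g \<in> U)"
  using assms(1,2)
proof induction
  case (Int a b)
  then obtain Y Y' where "finite Y" "\<forall>g\<in>sym_inv_monoid. A Y g \<longrightarrow> g \<in> a"
    "finite Y'" "\<forall>g\<in>sym_inv_monoid. A Y' g \<longrightarrow> g \<in> b"
    by auto
  then show ?case
    using anti[of Y "Y \<union> Y'"] anti[of Y' "Y \<union> Y'"] by (intro exI[of _ "Y \<union> Y'"]) auto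
next
  case (UN K)
  then obtain k where "k \<in> K" "h \<in> k"
    by blast
  with UN.IH show ?case
    by (metis UnionI)
qed (use assms(3) in auto)

lemma openin_I2_neighbourhood:
  assumes "openin I2 U" "h \<in> U"
  shows "\<exists>Y. finite Y \<and> (\<forall>g\<in>sym_inv_monoid. dom_agree Y g h \<longrightarrow> g \<in> U)"
proof (rule generated_neighbourhood)
  show "generate_topology_on ({U_set x y |x y. True} \<union> {W_set x |x. True}) U"
    using assms(1) by (simp add: I2_def openin_topology_generated_by_iff)
next
  fix S assume "S \<in> {U_set x y |x y. True} \<union> {W_set x |x. True}" "h \<in> S"
  then consider x y where "S = U_set x y" | x where "S = W_set x"
    by blast
  then show "\<exists>Y. finite Y \<and> (\<forall>g\<in>sym_inv_monoid. dom_agree Y g h \<longrightarrow> g \<in> S)"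
  proof cases
    case (1 x y)
    with \<open>h \<in> S\<close> show ?thesis
      by (intro exI[of _ "{x}"]) (auto simp: U_set_def dom_agree_def)
  next
    case (2 x)
    with \<open>h \<in> S\<close> show ?thesis
      by (intro exI[of _ "{x}"]) (auto simp: W_set_def dom_agree_def)
  qed
qed (use assms(2) in \<open>auto simp: dom_agree_def\<close>)

lemma openin_I3_neighbourhood:
  assumes "openin I3 U" "h \<in> U"
  shows "\<exists>Y. finite Y \<and> (\<forall>g\<in>sym_inv_monoid. im_agree Y g h \<longrightarrow> g \<in> U)"
proof (rule generated_neighbourhood)
  show "generate_topology_on ({U_set x y |x y. True} \<union> {W_inv_set x |x. True}) U"
    using assms(1) by (simp add: I3_def openin_topology_generated_by_iff)
next
  fix S assume "S \<in> {U_set x y |x y. True} \<union> {W_inv_set x |x. True}" "h \<in> S"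
  then consider x y where "S = U_set x y" | x where "S = W_inv_set x"
    by blast
  then show "\<exists>Y. finite Y \<and> (\<forall>g\<in>sym_inv_monoid. im_agree Y g h \<longrightarrow> g \<in> S)"
  proof cases
    case (1 x y)
    with \<open>h \<in> S\<close> show ?thesis
      by (intro exI[of _ "{y}"]) (auto simp: U_set_def im_agree_def)
  next
    case (2 y)
    with \<open>h \<in> S\<close> show ?thesis
      by (intro exI[of _ "{y}"]) (auto simp: W_inv_set_def im_agree_def)
  qed
qed (use assms(2) in \<open>auto simp: im_agree_def\<close>)

lemma openin_I4_neighbourhood:
  assumes "openin I4 U" "h \<in> U"
  shows "\<exists>Y. finite Y \<and> (\<forall>g\<in>sym_inv_monoid. dom_agree Y g h \<and> im_agree Y g h \<longrightarrow> g \<in> U)"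
proof (rule generated_neighbourhood)
  show "generate_topology_on (Collect (openin I2) \<union> Collect (openin I3)) U"
    using assms(1) by (simp add: I4_def openin_topology_generated_by_iff)
next
  fix S assume "S \<in> Collect (openin I2) \<union> Collect (openin I3)" "h \<in> S"
  then show "\<exists>Y. finite Y \<and> (\<forall>g\<in>sym_inv_monoid. dom_agree Y g h \<and> im_agree Y g h \<longrightarrow> g \<in> S)"
    using openin_I2_neighbourhood[of S h] openin_I3_neighbourhood[of S h] by blast
qed (use assms(2) in \<open>auto simp: dom_agree_def im_agree_def\<close>)

lemma openin_I2_extensions:
  assumes "finite p"
  shows "openin I2 {g \<in> sym_inv_monoid. p \<subseteq> g}"
  using assms
proof (induction p rule: finite_induct)
  case empty
  show ?case
    using openin_topspace[of I2] by (simp add: topspace_I2)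
next
  case (insert e p)
  have "openin I2 (U_set (fst e) (snd e))"
    unfolding I2_def by (intro topology_generated_by_Basis) blast
  moreover have "{g \<in> sym_inv_monoid. insert e p \<subseteq> g} =
      U_set (fst e) (snd e) \<inter> {g \<in> sym_inv_monoid. p \<subseteq> g}"
    by (auto simp: U_set_def)
  ultimately show ?case
    using insert.IH by (simp add: openin_Int)
qed

lemma openin_I2_dom_agree:
  assumes "finite Y" "h \<in> sym_inv_monoid"
  shows "openin I2 {g \<in> sym_inv_monoid. dom_agree Y g h}"
  using assms(1)
proof (induction Y rule: finite_induct)
  case empty
  show ?case
    using openin_topspace[of I2] by (simp add: topspace_I2 dom_agree_def)
next
  case (insert x Y)
  have "openin I2 {g \<in> sym_inv_monoid. dom_agree {x} g h}"
  proof (cases "x \<in> Domain h")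
    case True
    then obtain y where y: "(x, y) \<in> h"
      by blast
    then have "{g \<in> sym_inv_monoid. dom_agree {x} g h} = U_set x y"
      by (auto simp: dom_agree_def U_set_def dest: sym_inv_monoid_right_unique[of _ x y]
          sym_inv_monoid_right_unique[OF assms(2) y])
    then show ?thesis
      unfolding I2_def by (simp, intro topology_generated_by_Basis) blast
  next
    case False
    then have "{g \<in> sym_inv_monoid. dom_agree {x} g h} = W_set x"
      by (auto simp: dom_agree_def W_set_def)
    then show ?thesis
      unfolding I2_def by (simp, intro topology_generated_by_Basis) blast
  qed
  moreover have "{g \<in> sym_inv_monoid. dom_agree (insert x Y) g h} =
      {g \<in> sym_inv_monoid. dom_agree {x} g h} \<inter> {g \<in> sym_inv_monoid. dom_agree Y g h}"
    by (auto simp: dom_agree_def)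
  ultimately show ?case
    using insert.IH by (simp add: openin_Int)
qed

lemma openin_I3_im_agree:
  assumes "finite Y" "h \<in> sym_inv_monoid"
  shows "openin I3 {g \<in> sym_inv_monoid. im_agree Y g h}"
  using assms(1)
proof (induction Y rule: finite_induct)
  case empty
  show ?case
    using openin_topspace[of I3] by (simp add: topspace_I3 im_agree_def)
next
  case (insert y Y)
  have "openin I3 {g \<in> sym_inv_monoid. im_agree {y} g h}"
  proof (cases "y \<in> Range h")
    case True
    then obtain x where x: "(x, y) \<in> h"
      by blast
    then have "{g \<in> sym_inv_monoid. im_agree {y} g h} = U_set x y"
      by (auto simp: im_agree_def U_set_def dest: sym_inv_monoid_left_unique[of _ x y]
          sym_inv_monoid_left_unique[OF assms(2) x])
    then show ?thesis
      unfolding I3_def by (simp, intro topology_generated_by_Basis) blast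
  next
    case False
    then have "{g \<in> sym_inv_monoid. im_agree {y} g h} = W_inv_set y"
      by (auto simp: im_agree_def W_inv_set_def)
    then show ?thesis
      unfolding I3_def by (simp, intro topology_generated_by_Basis) blast
  qed
  moreover have "{g \<in> sym_inv_monoid. im_agree (insert y Y) g h} =
      {g \<in> sym_inv_monoid. im_agree {y} g h} \<inter> {g \<in> sym_inv_monoid. im_agree Y g h}"
    by (auto simp: im_agree_def)
  ultimately show ?case
    using insert.IH by (simp add: openin_Int)
qed

lemma topology_le_I2_I4: "topology_le I2 I4"
  unfolding I4_def by (rule topology_le_generated_by) blast

lemma topology_le_I3_I4: "topology_le I3 I4"
  unfolding I4_def by (rule topology_le_generated_by) blast


section \<open>Cardinalities in \<open>\<omega> + 1\<close>\<close>

lemma ecard_le_iff: "ecard A \<le> enat n \<longleftrightarrow> finite A \<and> card A \<le> n"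
  by (simp add: ecard_def)

lemma ecard_finite: "finite A \<Longrightarrow> ecard A = enat (card A)"
  by (simp add: ecard_def)

lemma ecard_mono: "A \<subseteq> B \<Longrightarrow> ecard A \<le> ecard B"
  by (auto simp: ecard_def card_mono finite_subset)

lemma enat_le_ecard_iff: "enat n \<le> ecard A \<longleftrightarrow> (\<exists>B \<subseteq> A. finite B \<and> card B = n)"
proof
  assume "enat n \<le> ecard A"
  then show "\<exists>B \<subseteq> A. finite B \<and> card B = n"
    by (cases "finite A")
      (auto simp: ecard_def elim: obtain_subset_with_card_n dest: infinite_arbitrarily_large)
next
  assume "\<exists>B \<subseteq> A. finite B \<and> card B = n"
  then show "enat n \<le> ecard A"
    by (metis ecard_finite ecard_mono)
qed

lemma ecard_Image_le:
  assumes "single_valued g"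
  shows "ecard (g `` R) \<le> ecard R"
proof (cases "finite R")
  case True
  have "g `` R \<subseteq> (\<lambda>x. SOME y. (x, y) \<in> g) ` R"
  proof
    fix y assume "y \<in> g `` R"
    then obtain x where x: "x \<in> R" "(x, y) \<in> g"
      by blast
    then have "(SOME y. (x, y) \<in> g) = y"
      using assms by (metis single_valuedD someI)
    with x show "y \<in> (\<lambda>x. SOME y. (x, y) \<in> g) ` R"
      by blast
  qed
  with True show ?thesis
    using surj_card_le[OF True] by (auto simp: ecard_def finite_subset)
qed (simp add: ecard_def)


section \<open>Waning functions\<close>

lemma waning_antimono: "waning f \<Longrightarrow> i \<le> j \<Longrightarrow> f j \<le> f i"
  by (auto simp: waning_def antimono_def)

lemma waning_step:
  assumes "waning f" "f (enat j) = enat m" "m \<noteq> 0"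
  shows "f (enat (Suc j)) < enat m"
proof -
  have "f (enat j) \<noteq> 0 \<and> f (enat j) \<noteq> \<infinity>"
    using assms by (simp add: zero_enat_def)
  then have "f (enat (j + 1)) < f (enat j)"
    using assms(1) unfolding waning_def by auto
  then show ?thesis
    using assms(2) by simp
qed

text \<open>Once finite, the values of a waning function drop at least as fast as the argument grows.\<close>

lemma waning_drop:
  assumes "waning f" "f (enat n) = enat m"
  shows "\<exists>k \<le> m - c. f (enat (n + c)) = enat k"
proof (induction c)
  case (Suc c)
  then obtain k where k: "k \<le> m - c" "f (enat (n + c)) = enat k"
    by blast
  show ?case
  proof (cases "k = 0")
    case True
    have "f (enat (n + Suc c)) \<le> f (enat (n + c))"
      by (rule waning_antimono[OF assms(1)]) simp
    with True k show ?thesis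
      by (auto simp: zero_enat_def[symmetric])
  next
    case False
    then have "f (enat (n + Suc c)) < enat k"
      using waning_step[OF assms(1) k(2)] by simp
    with k(1) show ?thesis
      by (cases "f (enat (n + Suc c))") auto
  qed
qed (use assms in simp)

text \<open>
  The value at \<open>\<infinity>\<close> carries no information of its own, as it is already attained at a finite argument.
\<close>

lemma waning_infinity:
  assumes "waning f"
  shows "(\<forall>i. f i = \<infinity>) \<or> f \<infinity> = 0 \<and> (\<exists>n. f (enat n) = 0)"
proof (cases "\<forall>i. f i = \<infinity>")
  case False
  then obtain n m where nm: "f (enat n) = enat m"
    using assms by (auto simp: waning_def)
  then have "f (enat (n + m)) = 0"
    using waning_drop[OF assms nm, of m] by (auto simp: zero_enat_def)
  moreover have "f \<infinity> \<le> f (enat (n + m))"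
    by (rule waning_antimono[OF assms]) simp
  ultimately show ?thesis
    by auto
qed simp


section \<open>The topology of a waning function is a Polish semigroup topology\<close>

lemma finite_Image_partial_bijection: "h \<in> sym_inv_monoid \<Longrightarrow> finite Y \<Longrightarrow> finite (h `` Y)"
  using ecard_Image_le[of h Y] by (auto simp: sym_inv_monoid_def ecard_def split: if_splits)

lemma finite_two_sided_restriction:
  assumes "h \<in> sym_inv_monoid" "finite Y"
  shows "finite {(x, y). (x, y) \<in> h \<and> (x \<in> Y \<or> y \<in> Y)}" (is "finite ?q")
proof -
  have "?q \<in> sym_inv_monoid"
    by (rule sym_inv_monoid_subset[OF assms(1)]) auto
  moreover have "Range ?q \<subseteq> Y \<union> h `` Y"
    by auto
  then have "finite (Range ?q)"
    using finite_Image_partial_bijection[OF assms] assms(2) by (meson finite_UnI finite_subset)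
  ultimately show ?thesis
    using finite_partial_bijection_iff by blast
qed

lemma finite_Id_on: "finite A \<Longrightarrow> finite (Id_on A)"
  by (rule finite_subset[of _ "A \<times> A"]) auto

lemma finite_restriction_in_open:
  assumes "openin I4 U" "h \<in> U"
  shows "\<exists>q \<subseteq> h. finite q \<and> q \<in> U"
proof -
  have h: "h \<in> sym_inv_monoid"
    using assms openin_subset[of I4] by (auto simp: topspace_I4)
  obtain Y where Y: "finite Y" "\<And>g. g \<in> sym_inv_monoid \<Longrightarrow> dom_agree Y g h \<Longrightarrow> im_agree Y g h \<Longrightarrow> g \<in> U"
    using openin_I4_neighbourhood[OF assms] by blast
  let ?q = "{(x, y). (x, y) \<in> h \<and> (x \<in> Y \<or> y \<in> Y)}"
  have q: "?q \<subseteq> h"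
    by auto
  have "?q \<in> U"
    by (rule Y(2)[OF sym_inv_monoid_subset[OF h q]]) (auto simp: dom_agree_def im_agree_def)
  then show ?thesis
    using q finite_two_sided_restriction[OF h Y(1)] by blast
qed

lemma topology_le_I2_T_fun: "topology_le I2 (T_fun f)"
  unfolding T_fun_def by (rule topology_le_generated_by) blast

lemma openin_T_fun_U_fun_set: "finite X \<Longrightarrow> openin (T_fun f) (U_fun_set f n X)"
  unfolding T_fun_def by (rule topology_generated_by_Basis) blast

lemma large_range_witness:
  assumes "h \<in> sym_inv_monoid" "enat n \<le> ecard (Range h - X)"
  obtains p where "p \<subseteq> h" "finite p" "enat n \<le> ecard (Range p - X)"
proof -
  obtain S where S: "S \<subseteq> Range h - X" "finite S" "card S = n"
    using assms(2) by (auto simp: enat_le_ecard_iff)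
  then obtain p where "p \<subseteq> h" "finite p" "Range p = S"
    using exists_restriction_with_range[OF assms(1), of S] by blast
  moreover have "enat n \<le> ecard (Range p - X)"
    using S \<open>Range p = S\<close> by (auto simp: enat_le_ecard_iff)
  ultimately show ?thesis
    using that by blast
qed

lemma openin_I2_large_range: "openin I2 {g \<in> sym_inv_monoid. enat n \<le> ecard (Range g - X)}"
proof (subst openin_subopen, intro ballI)
  fix h assume "h \<in> {g \<in> sym_inv_monoid. enat n \<le> ecard (Range g - X)}"
  then have h: "h \<in> sym_inv_monoid" "enat n \<le> ecard (Range h - X)"
    by auto
  then obtain p where p: "p \<subseteq> h" "finite p" "enat n \<le> ecard (Range p - X)"
    by (rule large_range_witness)
  have "enat n \<le> ecard (Range g - X)" if "p \<subseteq> g" for g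
    by (rule order_trans[OF p(3) ecard_mono]) (use Range_mono[OF that] in auto)
  then show "\<exists>T. openin I2 T \<and> h \<in> T \<and> T \<subseteq> {g \<in> sym_inv_monoid. enat n \<le> ecard (Range g - X)}"
    using h p openin_I2_extensions[OF p(2)]
    by (intro exI[of _ "{g \<in> sym_inv_monoid. p \<subseteq> g}"]) auto
qed

lemma U_fun_set_eq_infinity:
  assumes "f (enat n) = \<infinity>"
  shows "U_fun_set f n X = {g \<in> sym_inv_monoid. enat n \<le> ecard (Range g - X)}"
  using assms by (auto simp: U_fun_set_def)

text \<open>
  In \<open>\<I>\<^sub>4\<close> the trace \<open>X \<inter> Range h\<close> of the image on a finite set \<open>X\<close> can be kept constant near \<open>h\<close>,
  so bounding its size is an open condition whatever the bound.
\<close>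

lemma topology_le_T_fun_I4: "topology_le (T_fun f) I4"
  unfolding T_fun_def
proof (rule topology_generated_by_le)
  fix S assume "S \<in> Collect (openin I2) \<union> {U_fun_set f n X |n X. finite X}"
  then consider "openin I2 S" | n X where "S = U_fun_set f n X" "finite X"
    by blast
  then show "openin I4 S"
  proof cases
    case 1
    then show ?thesis
      using topology_le_I2_I4 by (simp add: topology_le_iff)
  next
    case 2
    show ?thesis
    proof (subst openin_subopen, intro ballI)
      fix h assume "h \<in> S"
      then have h: "h \<in> sym_inv_monoid" "enat n \<le> ecard (Range h - X)" "ecard (X \<inter> Range h) \<le> f (enat n)"
        by (auto simp: 2 U_fun_set_def)
      let ?V = "{g \<in> sym_inv_monoid. enat n \<le> ecard (Range g - X)} \<inter> {g \<in> sym_inv_monoid. im_agree X g h}"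
      have "openin I4 ?V"
        using openin_I2_large_range openin_I3_im_agree[OF 2(2) h(1)] topology_le_I2_I4 topology_le_I3_I4
        by (auto simp: topology_le_iff intro!: openin_Int)
      moreover have "h \<in> ?V"
        using h by (auto simp: im_agree_def)
      moreover have "?V \<subseteq> S"
      proof
        fix g assume g: "g \<in> ?V"
        then have "X \<inter> Range g = X \<inter> Range h"
          by (auto simp: im_agree_def)
        with g h show "g \<in> S"
          by (auto simp: 2 U_fun_set_def)
      qed
      ultimately show "\<exists>T. openin I4 T \<and> h \<in> T \<and> T \<subseteq> S"
        by blast
    qed
  qed
qed

text \<open>The countably many finite partial bijections are dense.\<close>

lemma separable_space_below_I4:
  assumes "topology_le T I4" "topspace T = sym_inv_monoid"
  shows "separable_space T"
  unfolding separable_space_def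
proof (intro exI conjI)
  let ?C = "{h \<in> sym_inv_monoid. finite h}"
  show "countable ?C"
    by (rule countable_subset[OF _ countable_Collect_finite]) auto
  show "?C \<subseteq> topspace T"
    using assms(2) by auto
  have "h \<in> T closure_of ?C" if "h \<in> sym_inv_monoid" for h
    unfolding in_closure_of
  proof (intro conjI allI impI)
    fix U assume U: "h \<in> U \<and> openin T U"
    then have "openin I4 U"
      using assms(1) by (auto simp: topology_le_iff)
    then obtain q where "q \<subseteq> h" "finite q" "q \<in> U"
      using finite_restriction_in_open U by blast
    then show "\<exists>y. y \<in> ?C \<and> y \<in> U"
      using that sym_inv_monoid_subset by blast
  qed (use that assms(2) in simp)
  then show "T closure_of ?C = topspace T"
    using closure_of_subset_topspace[of T ?C] assms(2) by auto
qed

text \<open>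
  Unlike in \<open>\<I>\<^sub>2\<close>, a limit may here be undefined at a point at which the approximating partial bijections are
  defined, if their values at that point tend to infinity.  This makes the space compact, and
  all the topologies \<^term>\<open>T_fun f\<close> arise from it by adding closed sets.
\<close>

definition pointwise_topology :: "nat rel topology" where
  "pointwise_topology =
     topology_generated_by (\<Union>x y. {U_set x y, sym_inv_monoid - U_set x y})"

lemma topspace_pointwise_topology: "topspace pointwise_topology = sym_inv_monoid"
  by (auto simp: pointwise_topology_def U_set_def)

lemma openin_pointwise_member:
  "openin pointwise_topology {h \<in> sym_inv_monoid. (x, y) \<in> h}"
  "openin pointwise_topology {h \<in> sym_inv_monoid. (x, y) \<notin> h}"
proof -
  have "{h \<in> sym_inv_monoid. (x, y) \<in> h} = U_set x y"
    "{h \<in> sym_inv_monoid. (x, y) \<notin> h} = sym_inv_monoid - U_set x y"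
    by (auto simp: U_set_def)
  then show "openin pointwise_topology {h \<in> sym_inv_monoid. (x, y) \<in> h}"
    "openin pointwise_topology {h \<in> sym_inv_monoid. (x, y) \<notin> h}"
    unfolding pointwise_topology_def by (auto intro!: topology_generated_by_Basis)
qed

text \<open>
  Through characteristic functions the pointwise topology becomes a subspace of
  \<open>2\<^bsup>\<nat>\<times>\<nat>\<^esup>\<close>, and being a partial bijection is a closed condition there because it
  only forbids certain pairs of points from lying in the graph together.
\<close>

lemma completely_metrizable_pointwise_topology: "completely_metrizable_space pointwise_topology"
proof -
  define P where "P = product_topology (\<lambda>_. discrete_topology (UNIV :: bool set)) (UNIV :: (nat \<times> nat) set)"
  define D where "D = {(a :: nat \<times> nat, b). fst a = fst b \<and> snd a \<noteq> snd b \<or> fst a \<noteq> fst b \<and> snd a = snd b}"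
  define S where "S = {s. \<forall>(a, b)\<in>D. \<not> (s a \<and> s b)}"
  have topP: "topspace P = UNIV"
    by (simp add: P_def)
  have ceval: "continuous_map P (discrete_topology UNIV) (\<lambda>s. s a)" for a
    unfolding P_def by (rule continuous_map_product_projection) simp
  have S_iff: "s \<in> S \<longleftrightarrow> {e. s e} \<in> sym_inv_monoid" for s
    by (auto simp: S_def D_def sym_inv_monoid_iff)
  have P: "completely_metrizable_space P"
    unfolding P_def by (rule completely_metrizable_space_power_bool) simp
  have "S = (\<Inter>(a, b)\<in>D. topspace P - ({s \<in> topspace P. s a \<in> {True}} \<inter> {s \<in> topspace P. s b \<in> {True}}))"
    by (auto simp: S_def topP)
  moreover have "closedin P \<dots>"
  proof (rule closedin_INT)
    have "((0, 0), (0, 1)) \<in> D"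
      by (simp add: D_def)
    then show "D \<noteq> {}"
      by blast
    have "openin P {s \<in> topspace P. s a \<in> {True}}" for a
      by (rule openin_continuous_map_preimage[OF ceval]) simp
    then show "closedin P (case d of (a, b) \<Rightarrow>
        topspace P - ({s \<in> topspace P. s a \<in> {True}} \<inter> {s \<in> topspace P. s b \<in> {True}}))" for d
      by (cases d) (metis (no_types, lifting) case_prod_conv closedin_diff closedin_topspace openin_Int)
  qed
  ultimately have "closedin P S"
    by simp
  with P have PS: "completely_metrizable_space (subtopology P S)"
    by (rule completely_metrizable_space_closedin)
  have "homeomorphic_maps pointwise_topology (subtopology P S) (\<lambda>h e. e \<in> h) Collect"
    unfolding homeomorphic_maps_def
  proof (intro conjI ballI)
    have "continuous_map pointwise_topology P (\<lambda>h e. e \<in> h)"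
      unfolding P_def continuous_map_componentwise_UNIV continuous_map_bool_iff
      using openin_pointwise_member by (auto simp: topspace_pointwise_topology)
    then show "continuous_map pointwise_topology (subtopology P S) (\<lambda>h e. e \<in> h)"
      by (simp add: continuous_map_in_subtopology image_subset_iff S_iff topspace_pointwise_topology)
    show "continuous_map (subtopology P S) pointwise_topology Collect"
      unfolding pointwise_topology_def
    proof (rule continuous_on_generated_topo)
      fix U assume "U \<in> (\<Union>x y. {U_set x y, sym_inv_monoid - U_set x y})"
      then obtain x y where "U = U_set x y \<or> U = sym_inv_monoid - U_set x y"
        by blast
      then have "U = {h \<in> sym_inv_monoid. ((x, y) \<in> h) = True} \<or>
          U = {h \<in> sym_inv_monoid. ((x, y) \<in> h) = False}"
        by (auto simp: U_set_def)
      then obtain b where b: "U = {h \<in> sym_inv_monoid. ((x, y) \<in> h) = b}"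
        by blast
      have "openin P {s \<in> topspace P. s (x, y) \<in> {b}}"
        by (rule openin_continuous_map_preimage[OF ceval]) simp
      moreover have "Collect -` U \<inter> topspace (subtopology P S)
          = {s \<in> topspace P. s (x, y) \<in> {b}} \<inter> S"
        by (auto simp: topP S_iff b)
      ultimately show "openin (subtopology P S) (Collect -` U \<inter> topspace (subtopology P S))"
        unfolding openin_subtopology by blast
    next
      have "Collect s \<in> \<Union> (\<Union>x y. {U_set x y, sym_inv_monoid - U_set x y})" if "s \<in> S" for s
        using that by (auto simp: S_iff U_set_def)
      then show "Collect ` topspace (subtopology P S) \<subseteq> \<Union> (\<Union>x y. {U_set x y, sym_inv_monoid - U_set x y})"
        by (auto simp: topP)
    qed
  qed auto
  then have "pointwise_topology homeomorphic_space subtopology P S"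
    unfolding homeomorphic_space_def by blast
  with PS show ?thesis
    by (simp add: homeomorphic_completely_metrizable_space)
qed

definition bounded_extensions :: "(enat \<Rightarrow> enat) \<Rightarrow> nat \<Rightarrow> nat set \<Rightarrow> nat rel \<Rightarrow> nat rel set" where
  "bounded_extensions f n X p = {g \<in> sym_inv_monoid. p \<subseteq> g \<and> ecard (X \<inter> Range g) \<le> f (enat n)}"

lemma closedin_pointwise_bounded_extensions:
  assumes "finite X"
  shows "closedin pointwise_topology (bounded_extensions f n X p)"
  unfolding closedin_def topspace_pointwise_topology
proof
  show "openin pointwise_topology (sym_inv_monoid - bounded_extensions f n X p)"
  proof (subst openin_subopen, intro ballI)
    fix h assume h: "h \<in> sym_inv_monoid - bounded_extensions f n X p"
    show "\<exists>T. openin pointwise_topology T \<and> h \<in> T \<and> T \<subseteq> sym_inv_monoid - bounded_extensions f n X p"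
    proof (cases "p \<subseteq> h")
      case True
      then have big: "\<not> ecard (X \<inter> Range h) \<le> f (enat n)"
        using h by (auto simp: bounded_extensions_def)
      obtain q where q: "q \<subseteq> h" "finite q" "Range q = X \<inter> Range h"
        using exists_restriction_with_range[of h "X \<inter> Range h"] h assms by auto
      have "openin pointwise_topology {g \<in> sym_inv_monoid. q \<subseteq> g}"
        using q(2)
      proof (induction q rule: finite_induct)
        case empty
        then show ?case
          using openin_topspace[of pointwise_topology] by (simp add: topspace_pointwise_topology)
      next
        case (insert e q)
        have "{g \<in> sym_inv_monoid. insert e q \<subseteq> g} =
            {g \<in> sym_inv_monoid. (fst e, snd e) \<in> g} \<inter> {g \<in> sym_inv_monoid. q \<subseteq> g}"
          by auto
        then show ?case
          by (simp only: openin_Int openin_pointwise_member(1) insert.IH)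
      qed
      moreover have "g \<notin> bounded_extensions f n X p" if "q \<subseteq> g" for g
      proof -
        have "X \<inter> Range h \<subseteq> X \<inter> Range g"
          using q(3) Range_mono[OF that] by auto
        then have "ecard (X \<inter> Range h) \<le> ecard (X \<inter> Range g)"
          by (rule ecard_mono)
        with big show ?thesis
          by (auto simp: bounded_extensions_def)
      qed
      ultimately show ?thesis
        using h q(1) by (intro exI[of _ "{g \<in> sym_inv_monoid. q \<subseteq> g}"]) auto
    next
      case False
      then obtain x y where "(x, y) \<in> p" "(x, y) \<notin> h"
        by auto
      then show ?thesis
        using h openin_pointwise_member(2)[of x y]
        by (intro exI[of _ "{g \<in> sym_inv_monoid. (x, y) \<notin> g}"]) (auto simp: bounded_extensions_def)
    qed
  qed
qed (auto simp: bounded_extensions_def)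

lemma closedin_pointwise_W_set: "closedin pointwise_topology (W_set x)"
proof -
  have "sym_inv_monoid - W_set x = (\<Union>y. U_set x y)"
    by (auto simp: W_set_def U_set_def)
  moreover have "openin pointwise_topology (U_set x y)" for y
    unfolding pointwise_topology_def by (rule topology_generated_by_Basis) blast
  ultimately show ?thesis
    by (auto simp: closedin_def topspace_pointwise_topology W_set_def)
qed

text \<open>
  The set \<^term>\<open>U_fun_set f n X\<close> is the union of the sets \<^term>\<open>bounded_extensions f n X p\<close> over
  the finite \<open>p\<close> that have \<open>n\<close> points outside \<open>X\<close> in their image.  Unlike
  \<^term>\<open>U_fun_set f n X\<close> itself these pieces are closed, already for pointwise convergence.
\<close>

lemma T_fun_eq_add_closed_sets:
  "T_fun f = topology_generated_by (Collect (openin pointwise_topology) \<union> (range W_set \<union>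
     {bounded_extensions f n X p | n X p. finite X \<and> finite p \<and> enat n \<le> ecard (Range p - X)}))"
  (is "_ = topology_generated_by ?\<S>")
proof (rule topology_le_antisym)
  let ?R = "topology_generated_by ?\<S>"
  have basis: "openin ?R S" if "S \<in> ?\<S>" for S
    using that by (rule topology_generated_by_Basis)
  have U: "openin ?R (U_set x y)" for x y
  proof -
    have "openin pointwise_topology (U_set x y)"
      unfolding pointwise_topology_def by (rule topology_generated_by_Basis) blast
    then show ?thesis
      by (intro basis) blast
  qed
  have "topology_le I2 ?R"
    unfolding I2_def
  proof (rule topology_generated_by_le)
    fix S assume "S \<in> {U_set x y |x y. True} \<union> {W_set x |x. True}"
    then consider x y where "S = U_set x y" | x where "S = W_set x"
      by blast
    then show "openin ?R S"
      by cases (use U in simp, intro basis, blast)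
  qed
  then have I2: "openin ?R S" if "openin I2 S" for S
    using that by (simp add: topology_le_iff)
  show "topology_le (T_fun f) ?R"
    unfolding T_fun_def
  proof (rule topology_generated_by_le)
    fix S assume "S \<in> Collect (openin I2) \<union> {U_fun_set f n X |n X. finite X}"
    then consider "openin I2 S" | n X where "S = U_fun_set f n X" "finite X"
      by blast
    then show "openin ?R S"
    proof cases
      case 2
      show ?thesis
      proof (subst openin_subopen, intro ballI)
        fix h assume "h \<in> S"
        then have h: "h \<in> sym_inv_monoid" "enat n \<le> ecard (Range h - X)" "ecard (X \<inter> Range h) \<le> f (enat n)"
          by (auto simp: 2 U_fun_set_def)
        from h(1,2) obtain p where p: "p \<subseteq> h" "finite p" "enat n \<le> ecard (Range p - X)"
          by (rule large_range_witness)
        have "openin ?R (bounded_extensions f n X p)"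
          using 2(2) p by (intro basis) blast
        moreover have "bounded_extensions f n X p \<subseteq> S"
        proof
          fix g assume g: "g \<in> bounded_extensions f n X p"
          then have "Range p - X \<subseteq> Range g - X"
            by (auto simp: bounded_extensions_def)
          then have "enat n \<le> ecard (Range g - X)"
            using p(3) ecard_mono order_trans by blast
          with g show "g \<in> S"
            by (auto simp: 2 U_fun_set_def bounded_extensions_def)
        qed
        moreover have "h \<in> bounded_extensions f n X p"
          using h p by (auto simp: bounded_extensions_def)
        ultimately show "\<exists>T. openin ?R T \<and> h \<in> T \<and> T \<subseteq> S"
          by blast
      qed
    qed (rule I2)
  qed
  have I2': "openin (T_fun f) S" if "openin I2 S" for S
    using that topology_le_I2_T_fun by (simp add: topology_le_iff)
  have pw: "topology_le pointwise_topology (T_fun f)"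
    unfolding pointwise_topology_def
  proof (rule topology_generated_by_le)
    fix S assume "S \<in> (\<Union>x y. {U_set x y, sym_inv_monoid - U_set x y})"
    then obtain x y where "S = U_set x y \<or> S = sym_inv_monoid - U_set x y"
      by blast
    then show "openin (T_fun f) S"
    proof
      assume "S = U_set x y"
      then show ?thesis
        by (intro I2') (auto simp: I2_def intro!: topology_generated_by_Basis)
    next
      assume S: "S = sym_inv_monoid - U_set x y"
      have "openin I2 S"
      proof (subst openin_subopen, intro ballI)
        fix h assume h: "h \<in> S"
        then have "openin I2 {g \<in> sym_inv_monoid. dom_agree {x} g h}"
          by (intro openin_I2_dom_agree) (auto simp: S)
        then show "\<exists>T. openin I2 T \<and> h \<in> T \<and> T \<subseteq> S"
          using h by (intro exI[of _ "{g \<in> sym_inv_monoid. dom_agree {x} g h}"])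
            (auto simp: S U_set_def dom_agree_def)
      qed
      then show ?thesis
        by (rule I2')
    qed
  qed
  show "topology_le ?R (T_fun f)"
  proof (rule topology_generated_by_le)
    fix S assume "S \<in> ?\<S>"
    then consider "openin pointwise_topology S" | x where "S = W_set x"
      | n X p where "S = bounded_extensions f n X p" "finite X" "finite p" "enat n \<le> ecard (Range p - X)"
      by blast
    then show "openin (T_fun f) S"
    proof cases
      case 1
      with pw show ?thesis
        by (simp add: topology_le_iff)
    next
      case 2
      then show ?thesis
        by (intro I2') (auto simp: I2_def intro!: topology_generated_by_Basis)
    next
      case 3
      have "enat n \<le> ecard (Range g - X)" if "p \<subseteq> g" for g
        by (rule order_trans[OF 3(4) ecard_mono]) (use Range_mono[OF that] in auto)
      then have "S = U_fun_set f n X \<inter> {g \<in> sym_inv_monoid. p \<subseteq> g}"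
        by (auto simp: 3(1) U_fun_set_def bounded_extensions_def)
      then show ?thesis
        using openin_T_fun_U_fun_set[OF 3(2)] I2'[OF openin_I2_extensions[OF 3(3)]]
        by (simp add: openin_Int)
    qed
  qed
qed

lemma Polish_space_T_fun: "Polish_space (T_fun f)"
  unfolding Polish_space_def
proof
  show "separable_space (T_fun f)"
    by (rule separable_space_below_I4[OF topology_le_T_fun_I4 topspace_T_fun])
  let ?B = "{bounded_extensions f n X p | n X p. finite X \<and> finite p \<and> enat n \<le> ecard (Range p - X)}"
  have "?B \<subseteq> (\<lambda>(n, X, p). bounded_extensions f n X p) ` (UNIV \<times> Collect finite \<times> Collect finite)"
    by auto
  then have "countable ?B"
    by (rule countable_subset) (intro countable_image countable_SIGMA countable_Collect_finite countableI_type)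
  then show "completely_metrizable_space (T_fun f)"
    unfolding T_fun_eq_add_closed_sets
    by (intro completely_metrizable_space_add_closed_sets completely_metrizable_pointwise_topology)
      (auto simp: closedin_pointwise_W_set closedin_pointwise_bounded_extensions)
qed

lemma dom_agree_relcomp:
  assumes "dom_agree Y h' h" "dom_agree (h `` Y) k' k"
  shows "dom_agree Y (h' O k') (h O k)"
  using assms unfolding dom_agree_def relcomp_unfold by blast

lemma semigroup_topology_generated_byI:
  assumes top: "topspace T = sym_inv_monoid"
    and T: "T = topology_generated_by \<S>"
    and nbhd: "\<And>S h k. S \<in> \<S> \<Longrightarrow> h \<in> sym_inv_monoid \<Longrightarrow> k \<in> sym_inv_monoid \<Longrightarrow> h O k \<in> S \<Longrightarrow>
      \<exists>A B. openin T A \<and> openin T B \<and> h \<in> A \<and> k \<in> B \<and> (\<forall>h'\<in>A. \<forall>k'\<in>B. h' O k' \<in> S)"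
  shows "semigroup_topology T"
  unfolding semigroup_topology_def
proof
  have "continuous_map (prod_topology T T) (topology_generated_by \<S>) (\<lambda>(f, g). f O g)"
  proof (rule continuous_on_generated_topo)
    fix S assume S: "S \<in> \<S>"
    show "openin (prod_topology T T) ((\<lambda>(f, g). f O g) -` S \<inter> topspace (prod_topology T T))"
      unfolding openin_prod_topology_alt
    proof (intro allI impI)
      fix h k assume "(h, k) \<in> (\<lambda>(f, g). f O g) -` S \<inter> topspace (prod_topology T T)"
      then have "h \<in> sym_inv_monoid" "k \<in> sym_inv_monoid" "h O k \<in> S"
        by (auto simp: top)
      then obtain A B where AB: "openin T A" "openin T B" "h \<in> A" "k \<in> B"
        "\<And>h' k'. h' \<in> A \<Longrightarrow> k' \<in> B \<Longrightarrow> h' O k' \<in> S"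
        using nbhd[OF S] by metis
      then have "A \<times> B \<subseteq> (\<lambda>(f, g). f O g) -` S \<inter> topspace (prod_topology T T)"
        using openin_subset[OF AB(1)] openin_subset[OF AB(2)] by auto
      with AB(1-4) show "\<exists>U V. openin T U \<and> openin T V \<and> h \<in> U \<and> k \<in> V \<and>
          U \<times> V \<subseteq> (\<lambda>(f, g). f O g) -` S \<inter> topspace (prod_topology T T)"
        by blast
    qed
  next
    have "\<Union> \<S> = sym_inv_monoid"
      using top by (simp add: T)
    then show "(\<lambda>(f, g). f O g) ` topspace (prod_topology T T) \<subseteq> \<Union> \<S>"
      by (auto simp: top sym_inv_monoid_relcomp)
  qed
  then show "continuous_map (prod_topology T T) T (\<lambda>(f, g). f O g)"
    by (simp add: T)
qed (rule top)

lemma I2_mult_neighbourhoods: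
  assumes "openin I2 S" "h \<in> sym_inv_monoid" "k \<in> sym_inv_monoid" "h O k \<in> S"
  shows "\<exists>A B. openin I2 A \<and> openin I2 B \<and> h \<in> A \<and> k \<in> B \<and> (\<forall>h'\<in>A. \<forall>k'\<in>B. h' O k' \<in> S)"
proof -
  obtain Y where Y: "finite Y" "\<And>g. g \<in> sym_inv_monoid \<Longrightarrow> dom_agree Y g (h O k) \<Longrightarrow> g \<in> S"
    using openin_I2_neighbourhood[OF assms(1,4)] by blast
  have "finite (h `` Y)"
    using finite_Image_partial_bijection[OF assms(2) Y(1)] .
  let ?A = "{g \<in> sym_inv_monoid. dom_agree Y g h}"
  let ?B = "{g \<in> sym_inv_monoid. dom_agree (h `` Y) g k}"
  have "openin I2 ?A" "openin I2 ?B"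
    using Y(1) \<open>finite (h `` Y)\<close> assms(2,3) by (simp_all add: openin_I2_dom_agree)
  moreover have "h \<in> ?A" "k \<in> ?B"
    using assms(2,3) by (simp_all add: dom_agree_refl)
  moreover have "\<forall>h'\<in>?A. \<forall>k'\<in>?B. h' O k' \<in> S"
    by (simp add: Y(2) sym_inv_monoid_relcomp dom_agree_relcomp)
  ultimately show ?thesis
    by (intro exI conjI)
qed

text \<open>
  Continuity of the product \<open>hk\<close> at the condition that at most \<open>f n\<close> points of \<open>X\<close> lie in
  the image.  If \<open>k\<close> satisfies the condition, so do its neighbours, and the image of a product lies in
  the image of the right factor.  Otherwise \<open>k\<close> has \<open>c > f n\<close> points of \<open>X\<close> and at least \<open>n\<close>
  other points in its image.  Since \<open>f\<close> is waning, \<open>f (n + c) = 0\<close>, so near \<open>k\<close> no further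
  points of \<open>X\<close> enter the image; it remains to bound the number of preimages of points of \<open>X\<close>
  that enter the image of \<open>h\<close>.
\<close>

lemma T_fun_mult_neighbourhoods:
  assumes f: "waning f" and X: "finite X" and h: "h \<in> sym_inv_monoid" and k: "k \<in> sym_inv_monoid"
    and hk: "h O k \<in> U_fun_set f n X"
  shows "\<exists>A B. openin (T_fun f) A \<and> openin (T_fun f) B \<and> h \<in> A \<and> k \<in> B \<and>
    (\<forall>h'\<in>A. \<forall>k'\<in>B. ecard (X \<inter> Range (h' O k')) \<le> f (enat n))"
proof (cases "f (enat n)")
  case infinity
  then show ?thesis
    using h k openin_topspace[of "T_fun f"] by (auto simp: topspace_T_fun)
next
  case (enat m)
  have big: "enat n \<le> ecard (Range (h O k) - X)" and small: "ecard (X \<inter> Range (h O k)) \<le> enat m"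
    using hk enat by (auto simp: U_fun_set_def)
  show ?thesis
  proof (cases "card (X \<inter> Range k) \<le> m")
    case True
    have "ecard (Range (h O k) - X) \<le> ecard (Range k - X)"
      by (rule ecard_mono) auto
    with big have "enat n \<le> ecard (Range k - X)"
      by (rule order_trans)
    with True have "k \<in> U_fun_set f n X"
      using k X enat by (simp add: U_fun_set_def ecard_le_iff)
    moreover have "ecard (X \<inter> Range (h' O k')) \<le> f (enat n)" if "k' \<in> U_fun_set f n X" for h' k'
    proof -
      have "ecard (X \<inter> Range (h' O k')) \<le> ecard (X \<inter> Range k')"
        by (rule ecard_mono) auto
      with that show ?thesis
        by (auto simp: U_fun_set_def)
    qed
    ultimately show ?thesis
      using h openin_T_fun_U_fun_set[OF X, of f n] openin_topspace[of "T_fun f"]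
      by (intro exI[of _ sym_inv_monoid] exI[of _ "U_fun_set f n X"]) (auto simp: topspace_T_fun)
  next
    case False
    define c where "c = card (X \<inter> Range k)"
    obtain q where q: "q \<subseteq> k" "finite q" "Range q = X \<inter> Range k"
      using exists_restriction_with_range[OF k, of "X \<inter> Range k"] X by auto
    have zero: "f (enat (n + c)) = 0"
      using waning_drop[OF f enat, of c] False by (auto simp: c_def zero_enat_def)
    obtain S where S: "S \<subseteq> Range (h O k) - X" "finite S" "card S = n"
      using big by (auto simp: enat_le_ecard_iff)
    let ?X = "X - Range k"
    have kin: "k \<in> U_fun_set f (n + c) ?X"
    proof -
      have "card (S \<union> (X \<inter> Range k)) = n + c"
        using S X unfolding c_def by (subst card_Un_disjoint) auto
      moreover have "S \<union> (X \<inter> Range k) \<subseteq> Range k - ?X"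
        using S(1) by auto
      moreover have "finite (S \<union> (X \<inter> Range k))"
        using S(2) X by simp
      ultimately have "enat (n + c) \<le> ecard (Range k - ?X)"
        unfolding enat_le_ecard_iff by blast
      moreover have "?X \<inter> Range k = {}"
        by auto
      ultimately show ?thesis
        using k zero by (simp add: U_fun_set_def ecard_def zero_enat_def)
    qed
    let ?Y = "Domain q"
    have fY: "finite ?Y"
      using q(2) by (rule finite_Domain)
    have hin: "h \<in> U_fun_set f n ?Y"
    proof -
      have "S \<subseteq> k `` (Range h - ?Y)"
      proof
        fix z assume "z \<in> S"
        then obtain x y where "(x, y) \<in> h" "(y, z) \<in> k" "z \<notin> X"
          using S(1) by blast
        moreover have "y \<notin> ?Y"
        proof
          assume "y \<in> ?Y"
          then obtain w where "(y, w) \<in> q"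
            by blast
          then show False
            using sym_inv_monoid_right_unique[OF k \<open>(y, z) \<in> k\<close>, of w] q(1,3) \<open>z \<notin> X\<close> by blast
        qed
        ultimately show "z \<in> k `` (Range h - ?Y)"
          by blast
      qed
      then have "enat n \<le> ecard (k `` (Range h - ?Y))"
        using S by (auto simp: enat_le_ecard_iff)
      also have "\<dots> \<le> ecard (Range h - ?Y)"
        using k by (intro ecard_Image_le) (simp add: sym_inv_monoid_def)
      finally have 1: "enat n \<le> ecard (Range h - ?Y)" .
      have "?Y \<inter> Range h \<subseteq> k\<inverse> `` (X \<inter> Range (h O k))"
        using q(1,3) by blast
      then have "ecard (?Y \<inter> Range h) \<le> ecard (k\<inverse> `` (X \<inter> Range (h O k)))"
        by (rule ecard_mono)
      also have "\<dots> \<le> ecard (X \<inter> Range (h O k))"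
        using k by (intro ecard_Image_le) (simp add: sym_inv_monoid_def)
      also note small
      finally show ?thesis
        using h 1 enat by (simp add: U_fun_set_def)
    qed
    let ?B = "U_fun_set f (n + c) ?X \<inter> {g \<in> sym_inv_monoid. q \<subseteq> g}"
    have "ecard (X \<inter> Range (h' O k')) \<le> f (enat n)" if h': "h' \<in> U_fun_set f n ?Y" and k': "k' \<in> ?B" for h' k'
    proof -
      have k'M: "k' \<in> sym_inv_monoid"
        using k' by auto
      have "ecard (?X \<inter> Range k') \<le> enat 0"
        using k' zero by (simp add: U_fun_set_def zero_enat_def)
      then have "?X \<inter> Range k' = {}"
        using X by (simp add: ecard_le_iff)
      then have XR: "X \<inter> Range k' \<subseteq> Range q"
        using q(3) by auto
      have "X \<inter> Range (h' O k') \<subseteq> k' `` (?Y \<inter> Range h')"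
      proof
        fix z assume z: "z \<in> X \<inter> Range (h' O k')"
        then obtain x y where xy: "(x, y) \<in> h'" "(y, z) \<in> k'"
          by blast
        with z XR obtain w where w: "(w, z) \<in> q"
          by blast
        then have "w = y"
          using sym_inv_monoid_left_unique[OF k'M _ xy(2), of w] k' by blast
        with w xy show "z \<in> k' `` (?Y \<inter> Range h')"
          by blast
      qed
      then have "ecard (X \<inter> Range (h' O k')) \<le> ecard (k' `` (?Y \<inter> Range h'))"
        by (rule ecard_mono)
      also have "\<dots> \<le> ecard (?Y \<inter> Range h')"
        using k'M by (intro ecard_Image_le) (simp add: sym_inv_monoid_def)
      also have "\<dots> \<le> f (enat n)"
        using h' by (simp add: U_fun_set_def)
      finally show ?thesis .
    qed
    moreover have "openin (T_fun f) ?B"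
      using openin_I2_extensions[OF q(2)] topology_le_I2_T_fun X
      by (intro openin_Int openin_T_fun_U_fun_set) (auto simp: topology_le_iff)
    moreover have "k \<in> ?B"
      using kin k q(1) by simp
    ultimately show ?thesis
      using openin_T_fun_U_fun_set[OF fY, of f n] hin
      by (intro exI[of _ "U_fun_set f n ?Y"] exI[of _ ?B]) blast
  qed
qed

lemma semigroup_topology_T_fun:
  assumes f: "waning f"
  shows "semigroup_topology (T_fun f)"
proof (rule semigroup_topology_generated_byI[OF topspace_T_fun T_fun_def])
  fix S h k
  assume S: "S \<in> Collect (openin I2) \<union> {U_fun_set f n X |n X. finite X}"
    and h: "h \<in> sym_inv_monoid" and k: "k \<in> sym_inv_monoid" and hk: "h O k \<in> S"
  have I2: "openin (T_fun f) A" if "openin I2 A" for A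
    using that topology_le_I2_T_fun by (simp add: topology_le_iff)
  from S consider "openin I2 S" | n X where "S = U_fun_set f n X" "finite X"
    by blast
  then show "\<exists>A B. openin (T_fun f) A \<and> openin (T_fun f) B \<and> h \<in> A \<and> k \<in> B \<and> (\<forall>h'\<in>A. \<forall>k'\<in>B. h' O k' \<in> S)"
  proof cases
    case 1
    then show ?thesis
      using I2_mult_neighbourhoods[OF 1 h k hk] I2 by blast
  next
    case 2
    let ?L = "{g \<in> sym_inv_monoid. enat n \<le> ecard (Range g - X)}"
    have "h O k \<in> ?L"
      using hk by (auto simp: 2 U_fun_set_def)
    then obtain A B where AB: "openin I2 A" "openin I2 B" "h \<in> A" "k \<in> B"
      "\<And>h' k'. h' \<in> A \<Longrightarrow> k' \<in> B \<Longrightarrow> h' O k' \<in> ?L"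
      using I2_mult_neighbourhoods[OF openin_I2_large_range h k, of n X] by blast
    obtain A' B' where AB': "openin (T_fun f) A'" "openin (T_fun f) B'" "h \<in> A'" "k \<in> B'"
      "\<And>h' k'. h' \<in> A' \<Longrightarrow> k' \<in> B' \<Longrightarrow> ecard (X \<inter> Range (h' O k')) \<le> f (enat n)"
      using T_fun_mult_neighbourhoods[OF f 2(2) h k, of n] hk 2(1) by blast
    have "h' O k' \<in> S" if "h' \<in> A \<inter> A'" "k' \<in> B \<inter> B'" for h' k'
      using AB(5)[of h' k'] AB'(5)[of h' k'] that by (simp add: 2 U_fun_set_def)
    then show ?thesis
      using AB(1-4) AB'(1-4) I2 by (intro exI[of _ "A \<inter> A'"] exI[of _ "B \<inter> B'"]) (auto intro: openin_Int)
  qed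
qed


section \<open>Comparing the topologies of two waning functions\<close>

text \<open>
  For \<open>h\<close> of finite rank the conditions defining \<^term>\<open>T_fun f\<close> only restrict how many new
  points enter the image, and the strictest bound among those available at \<open>h\<close> is \<open>f\<close> of the rank.
\<close>

lemma openin_T_fun_neighbourhood_finite_rank:
  assumes f: "waning f" and U: "openin (T_fun f) U" "h \<in> U" and fin: "finite h"
  shows "\<exists>Y. finite Y \<and> (\<forall>g\<in>sym_inv_monoid.
    dom_agree Y g h \<and> ecard (Range g - Range h) \<le> f (enat (card (Range h))) \<longrightarrow> g \<in> U)"
proof (rule generated_neighbourhood)
  show "generate_topology_on (Collect (openin I2) \<union> {U_fun_set f n X |n X. finite X}) U"
    using U(1) by (simp add: T_fun_def openin_topology_generated_by_iff)
next
  let ?r = "card (Range h)"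
  fix S assume S: "S \<in> Collect (openin I2) \<union> {U_fun_set f n X |n X. finite X}" and hS: "h \<in> S"
  from S consider "openin I2 S" | n X where "S = U_fun_set f n X" "finite X"
    by blast
  then show "\<exists>Y. finite Y \<and> (\<forall>g\<in>sym_inv_monoid.
    dom_agree Y g h \<and> ecard (Range g - Range h) \<le> f (enat ?r) \<longrightarrow> g \<in> S)"
  proof cases
    case 1
    then show ?thesis
      using openin_I2_neighbourhood[OF 1 hS] by blast
  next
    case 2
    have fR: "finite (Range h)"
      using fin by (rule finite_Range)
    have h: "enat n \<le> ecard (Range h - X)" "ecard (X \<inter> Range h) \<le> f (enat n)"
      using hS by (auto simp: 2 U_fun_set_def)
    have "g \<in> S" if g: "g \<in> sym_inv_monoid" "dom_agree (Domain h) g h"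
      "ecard (Range g - Range h) \<le> f (enat ?r)" for g
    proof -
      have sub: "Range h \<subseteq> Range g"
        using g(2) unfolding dom_agree_def by blast
      have "enat n \<le> ecard (Range g - X)"
        by (rule order_trans[OF h(1) ecard_mono]) (use sub in blast)
      moreover have "ecard (X \<inter> Range g) \<le> f (enat n)"
      proof (cases "f (enat n)")
        case (enat m)
        let ?c = "card (X \<inter> Range h)"
        have c: "?c \<le> m"
          using h(2) enat by (simp add: ecard_le_iff)
        obtain k where k: "k \<le> m - ?c" "f (enat (n + ?c)) = enat k"
          using waning_drop[OF f enat, of ?c] by blast
        have "n \<le> card (Range h - X)"
          using h(1) fR by (simp add: ecard_def)
        moreover have "card (Range h - X) + ?c = ?r"
          using fR card_Int_Diff[of "Range h" X] by (simp add: Int_commute)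
        ultimately have "n + ?c \<le> ?r"
          by simp
        then have "f (enat ?r) \<le> enat k"
          using waning_antimono[OF f, of "enat (n + ?c)" "enat ?r"] k(2) by simp
        with g(3) have new: "ecard (Range g - Range h) \<le> enat k"
          by (rule order_trans)
        have "X \<inter> Range g \<subseteq> (X \<inter> Range h) \<union> (Range g - Range h)"
          by auto
        moreover have fin': "finite (Range g - Range h)" "card (Range g - Range h) \<le> k"
          using new by (simp_all add: ecard_le_iff)
        ultimately have "card (X \<inter> Range g) \<le> card ((X \<inter> Range h) \<union> (Range g - Range h))"
          using fR by (intro card_mono) auto
        also have "\<dots> \<le> ?c + card (Range g - Range h)"
          by (rule card_Un_le)
        finally have "card (X \<inter> Range g) \<le> m"
          using fin' k(1) c by linarith
        then show ?thesis
          using 2(2) enat by (simp add: ecard_le_iff)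
      qed simp
      ultimately show ?thesis
        using g(1) by (simp add: 2 U_fun_set_def)
    qed
    then show ?thesis
      using finite_Domain[OF fin] by (intro exI[of _ "Domain h"]) blast
  qed
qed (use U(2) in \<open>auto simp: dom_agree_def\<close>)

text \<open>
  Let the image of \<open>h\<close> contain \<open>c\<close> points of \<open>X\<close> and \<open>n\<close> others.  Counting the \<open>c\<close> points with the
  others, \<open>h\<close> satisfies the condition with parameter \<open>n + c\<close> on the rest of \<open>X\<close>, and this allows
  at most \<open>g (n + c) \<le> f (n + c) \<le> f n - c\<close> new points there, so at most \<open>f n\<close> points of \<open>X\<close> in all.
\<close>

lemma T_fun_antimono:
  assumes f: "waning f" and le: "\<And>i. g i \<le> f i"
  shows "topology_le (T_fun f) (T_fun g)"
  unfolding T_fun_def[of f]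
proof (rule topology_generated_by_le)
  have I2: "openin (T_fun g) A" if "openin I2 A" for A
    using that topology_le_I2_T_fun by (simp add: topology_le_iff)
  fix S assume "S \<in> Collect (openin I2) \<union> {U_fun_set f n X |n X. finite X}"
  then consider "openin I2 S" | n X where "S = U_fun_set f n X" "finite X"
    by blast
  then show "openin (T_fun g) S"
  proof cases
    case 2
    show ?thesis
    proof (cases "f (enat n)")
      case infinity
      then show ?thesis
        using openin_I2_large_range by (simp add: 2 U_fun_set_eq_infinity I2)
    next
      case (enat m)
      show ?thesis
      proof (subst openin_subopen, intro ballI)
        fix h assume "h \<in> S"
        then have h: "h \<in> sym_inv_monoid" "enat n \<le> ecard (Range h - X)" "ecard (X \<inter> Range h) \<le> enat m"
          using enat by (auto simp: 2 U_fun_set_def)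
        define c where "c = card (X \<inter> Range h)"
        have c: "c \<le> m"
          using h(3) by (simp add: c_def ecard_le_iff)
        let ?X = "X - Range h"
        obtain k where k: "k \<le> m - c" "f (enat (n + c)) = enat k"
          using waning_drop[OF f enat, of c] by blast
        obtain B where B: "B \<subseteq> Range h - X" "finite B" "card B = n"
          using h(2) by (auto simp: enat_le_ecard_iff)
        have "card (B \<union> (X \<inter> Range h)) = n + c"
          using B 2(2) unfolding c_def by (subst card_Un_disjoint) auto
        moreover have "B \<union> (X \<inter> Range h) \<subseteq> Range h - ?X" "finite (B \<union> (X \<inter> Range h))"
          using B 2(2) by auto
        ultimately have "enat (n + c) \<le> ecard (Range h - ?X)"
          unfolding enat_le_ecard_iff by blast
        moreover have "?X \<inter> Range h = {}"
          by auto
        ultimately have hV: "h \<in> U_fun_set g (n + c) ?X"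
          using h(1) by (simp add: U_fun_set_def ecard_def zero_enat_def[symmetric])
        let ?V = "U_fun_set g (n + c) ?X \<inter> {g \<in> sym_inv_monoid. enat n \<le> ecard (Range g - X)}"
        have "openin (T_fun g) ?V"
          using 2(2) openin_I2_large_range by (intro openin_Int openin_T_fun_U_fun_set I2) auto
        moreover have "h \<in> ?V"
          using hV h by simp
        moreover have "?V \<subseteq> S"
        proof
          fix a assume a: "a \<in> ?V"
          then have "ecard (?X \<inter> Range a) \<le> enat k"
            using le[of "enat (n + c)"] k(2) by (auto simp: U_fun_set_def intro: order_trans)
          then have "card (?X \<inter> Range a) \<le> k"
            by (simp add: ecard_le_iff)
          moreover have "card (X \<inter> Range a) \<le> card ((X \<inter> Range h) \<union> (?X \<inter> Range a))"
            using 2(2) by (intro card_mono) auto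
          moreover have "\<dots> \<le> c + card (?X \<inter> Range a)"
            unfolding c_def by (rule card_Un_le)
          ultimately have "card (X \<inter> Range a) \<le> m"
            using k(1) c by linarith
          then show "a \<in> S"
            using a 2(2) enat by (simp add: 2(1) U_fun_set_def ecard_le_iff)
        qed
        ultimately show "\<exists>T. openin (T_fun g) T \<and> h \<in> T \<and> T \<subseteq> S"
          by blast
      qed
    qed
  qed (rule I2)
qed

text \<open>
  If \<open>f n < g n\<close>, consider the identity of an \<open>n\<close>-element set.  In \<^term>\<open>T_fun g\<close> it has neighbours
  with \<open>f n + 1\<close> prescribed new points in the image, which \<^term>\<open>T_fun f\<close> forbids.
\<close>

lemma T_fun_le_imp_values_ge:
  assumes g: "waning g" and le: "topology_le (T_fun f) (T_fun g)"
  shows "g (enat n) \<le> f (enat n)"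
proof (rule ccontr)
  assume "\<not> g (enat n) \<le> f (enat n)"
  then have less: "f (enat n) < g (enat n)"
    by simp
  then obtain m where m: "f (enat n) = enat m"
    by (cases "f (enat n)") auto
  have gm: "enat (Suc m) \<le> g (enat n)"
    using less m by (metis Suc_ile_eq)
  let ?h = "Id_on {..<n}"
  let ?X = "{n..<n + Suc m}"
  have R: "Range ?h = {..<n}"
    by auto
  have fin: "finite ?h"
    by (rule finite_subset[of _ "{..<n} \<times> {..<n}"]) auto
  have "?h \<in> U_fun_set f n ?X"
  proof -
    have "Range ?h - ?X = {..<n}" "?X \<inter> Range ?h = {}"
      using R by auto
    then show ?thesis
      by (simp add: U_fun_set_def sym_inv_monoid_Id_on ecard_def zero_enat_def[symmetric])
  qed
  moreover have "openin (T_fun g) (U_fun_set f n ?X)"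
    using le openin_T_fun_U_fun_set[of ?X f n] by (simp add: topology_le_iff)
  ultimately have "\<exists>Y. finite Y \<and> (\<forall>a\<in>sym_inv_monoid. dom_agree Y a ?h \<and>
      ecard (Range a - Range ?h) \<le> g (enat (card (Range ?h))) \<longrightarrow> a \<in> U_fun_set f n ?X)"
    by (intro openin_T_fun_neighbourhood_finite_rank[OF g _ _ fin])
  then obtain Y where Y: "finite Y" "\<And>a. a \<in> sym_inv_monoid \<Longrightarrow> dom_agree Y a ?h \<Longrightarrow>
      ecard (Range a - Range ?h) \<le> g (enat (card (Range ?h))) \<Longrightarrow> a \<in> U_fun_set f n ?X"
    by metis
  obtain N where N: "\<And>y. y \<in> Y \<union> {..<n} \<Longrightarrow> y < N"
    using Y(1) finite_nat_set_iff_bounded[of "Y \<union> {..<n}"] by auto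
  let ?b = "(\<lambda>x. (N + x, x)) ` ?X"
  let ?a = "?h \<union> ?b"
  have a: "?a \<in> sym_inv_monoid"
  proof (rule sym_inv_monoid_Un)
    show "?b \<in> sym_inv_monoid"
      by (rule sym_inv_monoid_pairs) simp_all
    show "Domain ?h \<inter> Domain ?b = {}"
      using N by fastforce
  qed (auto simp: sym_inv_monoid_Id_on)
  have "Range ?b = ?X"
    by (simp only: Range_snd image_image snd_conv image_ident)
  then have Ra: "Range ?a = {..<n} \<union> ?X"
    by (simp only: Range_Un_eq R)
  have "dom_agree Y ?a ?h"
    using N by (fastforce simp: dom_agree_def)
  moreover have "Range ?a - Range ?h = ?X"
    unfolding Ra R by auto
  ultimately have "?a \<in> U_fun_set f n ?X"
    using gm by (intro Y(2)[OF a]) (simp_all add: R ecard_def)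
  then have "ecard (?X \<inter> Range ?a) \<le> enat m"
    using m by (simp add: U_fun_set_def)
  moreover have "?X \<inter> Range ?a = ?X"
    unfolding Ra by auto
  ultimately show False
    by (simp add: ecard_le_iff)
qed

lemma waning_le_iff_finite_arguments:
  assumes "waning f" "waning g"
  shows "waning_le f g \<longleftrightarrow> (\<forall>n. g (enat n) \<le> f (enat n))"
proof
  assume le: "\<forall>n. g (enat n) \<le> f (enat n)"
  have "g \<infinity> \<le> f \<infinity>"
  proof (cases "\<forall>i. g i = \<infinity>")
    case True
    then have "\<forall>n. f (enat n) = \<infinity>"
      using le by (metis enat_ord_simps(5))
    then show ?thesis
      using assms(1) by (auto simp: waning_def)
  next
    case False
    then show ?thesis
      using waning_infinity[OF assms(2)] by auto
  qed
  then have "g i \<le> f i" for i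
    using le by (cases i) auto
  then show "waning_le f g"
    by (simp add: waning_le_def)
qed (simp add: waning_le_def)

lemma T_fun_le_iff:
  assumes "waning f" "waning g"
  shows "topology_le (T_fun f) (T_fun g) \<longleftrightarrow> waning_le f g"
  using T_fun_antimono[OF assms(1), of g] T_fun_le_imp_values_ge[OF assms(2), of f]
    waning_le_iff_finite_arguments[OF assms] by (auto simp: waning_le_def)

lemma waning_le_antisym: "waning_le f g \<Longrightarrow> waning_le g f \<Longrightarrow> f = g"
  by (auto simp: waning_le_def fun_eq_iff intro: antisym)

lemma inj_on_T_fun: "inj_on T_fun {f. waning f}"
proof (rule inj_onI)
  fix f g assume "f \<in> {f. waning f}" "g \<in> {f. waning f}" "T_fun f = T_fun g"
  moreover have "topology_le (T_fun g) (T_fun g)"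
    by (simp add: topology_le_def)
  ultimately show "f = g"
    using T_fun_le_iff[of f g] T_fun_le_iff[of g f] waning_le_antisym by auto
qed


section \<open>Semigroup topologies between \<open>\<I>\<^sub>2\<close> and \<open>\<I>\<^sub>4\<close>\<close>

locale intermediate_topology =
  fixes T :: "nat rel topology"
  assumes semigroup: "semigroup_topology T"
    and regular: "regular_space T"
    and above_I2: "topology_le I2 T"
    and below_I4: "topology_le T I4"
begin

lemma topspace: "topspace T = sym_inv_monoid"
  using semigroup by (simp add: semigroup_topology_def)

lemma openin_I2: "openin I2 U \<Longrightarrow> openin T U"
  using above_I2 by (simp add: topology_le_iff)

lemma openin_I4: "openin T U \<Longrightarrow> openin I4 U"
  using below_I4 by (simp add: topology_le_iff)

lemma mult_neighbourhoods:
  assumes "openin T U" "h \<in> sym_inv_monoid" "k \<in> sym_inv_monoid" "h O k \<in> U"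
  obtains A B where "openin T A" "openin T B" "h \<in> A" "k \<in> B"
    "\<And>h' k'. h' \<in> A \<Longrightarrow> k' \<in> B \<Longrightarrow> h' O k' \<in> U"
proof -
  let ?m = "\<lambda>(f, g). f O g :: nat rel"
  have cont: "continuous_map (prod_topology T T) T ?m"
    using semigroup by (simp add: semigroup_topology_def)
  have "openin (prod_topology T T) {p \<in> topspace (prod_topology T T). ?m p \<in> U}"
    by (rule openin_continuous_map_preimage[OF cont assms(1)])
  moreover have "(h, k) \<in> {p \<in> topspace (prod_topology T T). ?m p \<in> U}"
    using assms by (simp add: topspace)
  ultimately obtain A B where AB: "openin T A" "openin T B" "h \<in> A" "k \<in> B"
    "A \<times> B \<subseteq> {p \<in> topspace (prod_topology T T). ?m p \<in> U}"
    unfolding openin_prod_topology_alt by (elim allE impE) (assumption, blast)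
  have "h' O k' \<in> U" if "h' \<in> A" "k' \<in> B" for h' k'
    using AB(5) that by auto
  with AB(1-4) show ?thesis
    by (rule that)
qed

text \<open>
  A Polish semigroup topology between \<open>\<I>\<^sub>2\<close> and \<open>\<I>\<^sub>4\<close> is determined by which finite sets of points outside the
  image of \<open>h\<close> can be kept from being swallowed by the images of all neighbours of \<open>h\<close>.
\<close>

definition evades :: "nat rel \<Rightarrow> nat set \<Rightarrow> bool" where
  "evades h Z \<longleftrightarrow> (\<exists>V. openin T V \<and> h \<in> V \<and> (\<forall>g\<in>V. \<not> Z \<subseteq> Range g))"

lemma not_evades_empty: "\<not> evades h {}"
  by (auto simp: evades_def)

lemma evades_superset: "evades h Z \<Longrightarrow> Z \<subseteq> Z' \<Longrightarrow> evades h Z'"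
  unfolding evades_def by (meson order_trans)

lemma evades_finite_restriction:
  assumes "evades h Z"
  obtains q where "q \<subseteq> h" "finite q" "evades q Z"
proof -
  obtain V where V: "openin T V" "h \<in> V" "\<forall>g\<in>V. \<not> Z \<subseteq> Range g"
    using assms by (auto simp: evades_def)
  obtain q where "q \<subseteq> h" "finite q" "q \<in> V"
    using finite_restriction_in_open[OF openin_I4[OF V(1)] V(2)] by blast
  moreover from this have "evades q Z"
    using V(1,3) unfolding evades_def by blast
  ultimately show ?thesis
    by (intro that)
qed

text \<open>
  Write \<open>q = eh\<close> with \<open>e\<close> the identity of the domain of \<open>q\<close>.  If arbitrarily close to \<open>h\<close> there were
  \<open>h'\<close> with \<open>Z\<close> in the image, then the preimages of \<open>Z\<close> under \<open>h'\<close> would be far out, as \<open>h'\<close>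
  agrees with \<open>h\<close> on a large finite set.  A left factor close to \<open>e\<close> may take arbitrary
  values far out, so it can be chosen to hit these preimages, and the product would be close to \<open>q\<close>
  with \<open>Z\<close> in its image.
\<close>

lemma evades_extension:
  assumes h: "h \<in> sym_inv_monoid" and q: "q \<subseteq> h" and Z: "Z \<inter> Range h = {}"
    and ev: "evades q Z"
  shows "evades h Z"
proof -
  obtain V where V: "openin T V" "q \<in> V" "\<And>g. g \<in> V \<Longrightarrow> \<not> Z \<subseteq> Range g"
    using ev by (auto simp: evades_def)
  let ?e = "Id_on (Domain q)"
  have "?e O h = q"
  proof
    show "?e O h \<subseteq> q"
    proof
      fix p assume "p \<in> ?e O h"
      then obtain x y z where "p = (x, y)" "(x, y) \<in> h" "(x, z) \<in> q"
        by auto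
      then show "p \<in> q"
        using sym_inv_monoid_right_unique[OF h, of x y z] q by blast
    qed
  qed (use q in auto)
  then obtain A B where A: "openin T A" "?e \<in> A" and B: "openin T B" "h \<in> B"
    and AB: "\<And>a b. a \<in> A \<Longrightarrow> b \<in> B \<Longrightarrow> a O b \<in> V"
    using mult_neighbourhoods[OF V(1) sym_inv_monoid_Id_on h] V(2) by metis
  obtain Y where Y: "finite Y"
    "\<And>g. g \<in> sym_inv_monoid \<Longrightarrow> dom_agree Y g ?e \<Longrightarrow> im_agree Y g ?e \<Longrightarrow> g \<in> A"
    using openin_I4_neighbourhood[OF openin_I4[OF A(1)] A(2)] by blast
  let ?B = "B \<inter> {g \<in> sym_inv_monoid. dom_agree Y g h}"
  have "\<not> Z \<subseteq> Range h'" if h': "h' \<in> ?B" for h'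
  proof
    assume sub: "Z \<subseteq> Range h'"
    have h'M: "h' \<in> sym_inv_monoid" and agree: "dom_agree Y h' h"
      using h' by auto
    have "\<forall>z\<in>Z. \<exists>x. (x, z) \<in> h'"
      using sub by blast
    then obtain \<phi> where \<phi>: "\<And>z. z \<in> Z \<Longrightarrow> (\<phi> z, z) \<in> h'"
      by metis
    have notY: "\<phi> z \<notin> Y" if "z \<in> Z" for z
      using \<phi>[OF that] agree Z that unfolding dom_agree_def by blast
    have inj: "inj_on \<phi> Z"
      using \<phi> sym_inv_monoid_right_unique[OF h'M] by (metis inj_onI)
    obtain N where N: "\<And>y. y \<in> Y \<Longrightarrow> y < N"
      using Y(1) finite_nat_set_iff_bounded by auto
    let ?p = "(\<lambda>z. (N + z, \<phi> z)) ` Z"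
    let ?k = "Id_on (Domain q \<inter> Y) \<union> ?p"
    have far: "N + z \<notin> Y" for z
      using N by (meson add_lessD1 less_irrefl_nat)
    have "?k \<in> sym_inv_monoid"
    proof (rule sym_inv_monoid_Un)
      show "?p \<in> sym_inv_monoid"
        using inj by (intro sym_inv_monoid_pairs) simp_all
    qed (use far notY in \<open>auto simp: sym_inv_monoid_Id_on\<close>)
    moreover have "dom_agree Y ?k ?e"
      using far by (auto simp: dom_agree_def)
    moreover have "im_agree Y ?k ?e"
      using notY by (auto simp: im_agree_def)
    ultimately have "?k \<in> A"
      by (rule Y(2))
    then have "?k O h' \<in> V"
      using h' by (intro AB) auto
    moreover have "Z \<subseteq> Range (?k O h')"
    proof
      fix z assume "z \<in> Z"
      then have "(N + z, \<phi> z) \<in> ?k" "(\<phi> z, z) \<in> h'"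
        using \<phi> by auto
      then show "z \<in> Range (?k O h')"
        by (intro RangeI relcompI)
    qed
    ultimately show False
      using V(3) by blast
  qed
  moreover have "openin T ?B"
    using B(1) openin_I2[OF openin_I2_dom_agree[OF Y(1) h]] by (rule openin_Int)
  moreover have "h \<in> ?B"
    using B(2) h by (simp add: dom_agree_refl)
  ultimately show ?thesis
    unfolding evades_def by blast
qed

text \<open>
  The neighbourhoods of \<open>h\<close> are no finer than the unavoidable sets force them to be.  Suppose that \<open>h\<close>
  does not evade any set of at most \<open>m\<close> points outside its image, and let \<open>g\<close> be finite, agree with
  \<open>h\<close> on a large finite set and have at most \<open>m\<close> new points in its image that belong to a large
  finite set \<open>B\<close>.  Then \<open>g\<close> can be written as a product \<open>k h'' l\<close> in which \<open>k\<close> is close to the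
  identity of the domain of \<open>h\<close>, \<open>h''\<close> is close to \<open>h\<close> and \<open>l\<close> is close to the identity.  Here \<open>h''\<close> has
  the new points of \<open>g\<close> within \<open>B\<close> in its image, which is possible as \<open>h\<close> does not evade them,
  and as many points far out as \<open>g\<close> has image points outside \<open>B\<close>; \<open>l\<close> is the identity on \<open>B\<close>
  and moves the points far out to these places; then \<open>h'' l\<close> has all of the image of \<open>g\<close> in its
  image, and the left factor \<open>k\<close> adjusts the domain.  Infinite \<open>g\<close> are limits of finite ones, and
  regularity of the space permits passing to the limit.
\<close>

lemma neighbourhood_of_few_new_image_points:
  assumes U: "openin T U" "h \<in> U"
    and unavoidable: "\<And>Z. finite Z \<Longrightarrow> Z \<inter> Range h = {} \<Longrightarrow> ecard Z \<le> m \<Longrightarrow> \<not> evades h Z"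
  shows "\<exists>X Y. finite X \<and> finite Y \<and>
    (\<forall>g\<in>sym_inv_monoid. dom_agree Y g h \<and> ecard (X \<inter> Range g - Range h) \<le> m \<longrightarrow> g \<in> U)"
proof -
  have h: "h \<in> sym_inv_monoid"
    using U openin_subset[OF U(1)] by (auto simp: topspace)
  obtain U0 C where U0: "openin T U0" "h \<in> U0" "U0 \<subseteq> C" and C: "closedin T C" "C \<subseteq> U"
    using regular U unfolding neighbourhood_base_of_closedin[symmetric] neighbourhood_base_of
    by metis
  let ?e = "Id_on (Domain h)"
  have "?e O h = h"
    by auto
  then obtain V V' where V: "openin T V" "?e \<in> V" and V': "openin T V'" "h \<in> V'"
    and VV': "\<And>a b. a \<in> V \<Longrightarrow> b \<in> V' \<Longrightarrow> a O b \<in> U0"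
    using mult_neighbourhoods[OF U0(1) sym_inv_monoid_Id_on h] U0(2) by metis
  have "h O Id_on UNIV = h"
    by auto
  then obtain W W' where W: "openin T W" "h \<in> W" and W': "openin T W'" "Id_on UNIV \<in> W'"
    and WW': "\<And>a b. a \<in> W \<Longrightarrow> b \<in> W' \<Longrightarrow> a O b \<in> V'"
    using mult_neighbourhoods[OF V'(1) h sym_inv_monoid_Id_on, of UNIV] V'(2) by metis
  obtain F where F: "finite F"
    "\<And>g. g \<in> sym_inv_monoid \<Longrightarrow> dom_agree F g ?e \<Longrightarrow> im_agree F g ?e \<Longrightarrow> g \<in> V"
    using openin_I4_neighbourhood[OF openin_I4[OF V(1)] V(2)] by blast
  obtain E where E: "finite E"
    "\<And>g. g \<in> sym_inv_monoid \<Longrightarrow> dom_agree E g (Id_on UNIV) \<Longrightarrow> im_agree E g (Id_on UNIV) \<Longrightarrow> g \<in> W'"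
    using openin_I4_neighbourhood[OF openin_I4[OF W'(1)] W'(2)] by blast
  (* B contains the values of h on F so that l fixes them; then the product h'' l agrees with h on F,
     and k becomes the identity there. *)
  define B where "B = h `` F \<union> E"
  have finB: "finite B"
    unfolding B_def using finite_Image_partial_bijection[OF h F(1)] E(1) by simp
  define Y where "Y = F \<union> h\<inverse> `` B"
  have finY: "finite Y"
    unfolding Y_def using finite_Image_partial_bijection[OF sym_inv_monoid_converse[OF h] finB] F(1)
    by simp
  have fin_case: "g \<in> U0"
    if g: "g \<in> sym_inv_monoid" and fing: "finite g" and agree: "dom_agree Y g h"
      and few: "ecard (B \<inter> Range g - Range h) \<le> m" for g
  proof -
    define Z where "Z = B \<inter> Range g - Range h"
    let ?W = "W \<inter> {a \<in> sym_inv_monoid. dom_agree Y a h}"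
    have Wop: "openin T ?W"
      using W(1) openin_I2[OF openin_I2_dom_agree[OF finY h]] by (rule openin_Int)
    have "\<not> evades h Z"
      using few finB by (intro unavoidable) (auto simp: Z_def)
    moreover have "h \<in> ?W"
      using W(2) h by (simp add: dom_agree_refl)
    ultimately obtain h' where h': "h' \<in> ?W" "Z \<subseteq> Range h'"
      using Wop unfolding evades_def by blast
    have h'M: "h' \<in> sym_inv_monoid"
      using h'(1) by simp
    obtain G0 where G0: "finite G0"
      "\<And>g. g \<in> sym_inv_monoid \<Longrightarrow> dom_agree G0 g h' \<Longrightarrow> im_agree G0 g h' \<Longrightarrow> g \<in> ?W"
      using openin_I4_neighbourhood[OF openin_I4[OF Wop] h'(1)] by blast
    define G where "G = G0 \<union> Z"
    have finG: "finite G"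
      using G0(1) finB by (simp add: G_def Z_def)
    define h0 where "h0 = {(x, y). (x, y) \<in> h' \<and> (x \<in> G \<or> y \<in> G)}"
    have h0sub: "h0 \<subseteq> h'"
      by (auto simp: h0_def)
    have finh0: "finite h0"
      unfolding h0_def by (rule finite_two_sided_restriction[OF h'M finG])
    have h0M: "h0 \<in> sym_inv_monoid"
      using h'M h0sub by (rule sym_inv_monoid_subset)
    define R where "R = Range g - B"
    have "finite (G \<union> Domain h0 \<union> Range h0 \<union> B)"
      using finG finh0 finB by (simp add: finite_Domain finite_Range)
    then obtain N where "\<forall>x \<in> G \<union> Domain h0 \<union> Range h0 \<union> B. x < N"
      unfolding finite_nat_set_iff_bounded by blast
    then have far: "N + r \<notin> G \<union> Domain h0 \<union> Range h0 \<union> B" for r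
      by (meson add_lessD1 less_irrefl_nat)
    define new where "new = Id_on ((+) N ` R)"
    define h'' where "h'' = h0 \<union> new"
    define l where "l = Id_on B \<union> (\<lambda>r. (N + r, r)) ` R"
    have lM: "l \<in> sym_inv_monoid"
      unfolding l_def
    proof (rule sym_inv_monoid_Un)
      show "(\<lambda>r. (N + r, r)) ` R \<in> sym_inv_monoid"
        by (rule sym_inv_monoid_pairs) simp_all
    qed (use far in \<open>auto simp: sym_inv_monoid_Id_on R_def\<close>)
    have l_fix: "(x, z) \<in> l \<longleftrightarrow> x = z" if "x \<in> B" for x z
      using that far by (auto simp: l_def)
    have "dom_agree E l (Id_on UNIV)"
      using l_fix by (auto simp: dom_agree_def B_def)
    moreover have "im_agree E l (Id_on UNIV)"
      by (auto simp: im_agree_def l_def B_def R_def)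
    ultimately have lW: "l \<in> W'"
      by (intro E(2)[OF lM])
    have h''M: "h'' \<in> sym_inv_monoid"
      unfolding h''_def new_def
      by (rule sym_inv_monoid_Un) (use far in \<open>auto simp: sym_inv_monoid_Id_on h0M\<close>)
    have new_far: "x \<notin> G \<and> y \<notin> G" if "(x, y) \<in> new" for x y
      using that far by (auto simp: new_def)
    have "dom_agree G0 h'' h'" "im_agree G0 h'' h'"
      using new_far by (auto simp: dom_agree_def im_agree_def h''_def h0_def G_def)
    then have h''W: "h'' \<in> ?W"
      by (intro G0(2)[OF h''M])
    define a where "a = h'' O l"
    have aM: "a \<in> sym_inv_monoid"
      unfolding a_def using h''M lM by (rule sym_inv_monoid_relcomp)
    have aV: "a \<in> V'"
      unfolding a_def using h''W lW by (intro WW') auto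
    have h''_Y: "(x, y) \<in> h'' \<longleftrightarrow> (x, y) \<in> h" if "x \<in> Y" for x y
      using h''W that by (simp add: dom_agree_def)
    have g_Y: "(x, y) \<in> g \<longleftrightarrow> (x, y) \<in> h" if "x \<in> Y" for x y
      using agree that by (simp add: dom_agree_def)
    have a_F: "(x, z) \<in> a \<longleftrightarrow> (x, z) \<in> g" if x: "x \<in> F" for x z
    proof -
      have xY: "x \<in> Y"
        using x by (simp add: Y_def)
      have "w \<in> B" if "(x, w) \<in> h''" for w
        using that x h''_Y[OF xY] by (auto simp: B_def)
      then show ?thesis
        unfolding a_def relcomp_unfold using h''_Y[OF xY] g_Y[OF xY] l_fix by auto
    qed
    have g_F: "x \<in> Domain g \<longleftrightarrow> x \<in> Domain h" if "x \<in> F" for x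
      using g_Y[of x] that by (auto simp: Y_def)
    have Rga: "Range g \<subseteq> Range a"
    proof
      fix z assume z: "z \<in> Range g"
      consider "z \<notin> B" | w where "z \<in> B" "(w, z) \<in> h" | "z \<in> B" "z \<notin> Range h"
        by blast
      then show "z \<in> Range a"
      proof cases
        case 1
        then have "(N + z, N + z) \<in> h''" "(N + z, z) \<in> l"
          using z by (auto simp: R_def h''_def new_def l_def)
        then show ?thesis
          unfolding a_def by blast
      next
        case 2
        then have "w \<in> Y"
          by (auto simp: Y_def)
        then have "(w, z) \<in> h''" "(z, z) \<in> l"
          using 2 h''_Y l_fix by auto
        then show ?thesis
          unfolding a_def by blast
      next
        case 3
        then have "z \<in> Z"
          using z by (simp add: Z_def)
        then obtain w where "(w, z) \<in> h'"
          using h'(2) by blast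
        then have "(w, z) \<in> h''" "(z, z) \<in> l"
          using \<open>z \<in> Z\<close> 3 l_fix by (auto simp: h''_def h0_def G_def)
        then show ?thesis
          unfolding a_def by blast
      qed
    qed
    define k where "k = g O a\<inverse>"
    have kM: "k \<in> sym_inv_monoid"
      unfolding k_def using g sym_inv_monoid_converse[OF aM] by (rule sym_inv_monoid_relcomp)
    have "dom_agree F k ?e"
      unfolding dom_agree_def
    proof (intro ballI allI iffI)
      fix x y assume x: "x \<in> F" and "(x, y) \<in> k"
      then obtain z where z: "(x, z) \<in> g" "(y, z) \<in> a"
        by (auto simp: k_def)
      then have "x = y"
        using sym_inv_monoid_left_unique[OF aM, of x z y] a_F[OF x] by blast
      then show "(x, y) \<in> ?e"
        using z(1) g_F[OF x] by blast
    next
      fix x y assume x: "x \<in> F" and "(x, y) \<in> ?e"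
      then obtain z where "y = x" "(x, z) \<in> g"
        using g_F[OF x] by auto
      then show "(x, y) \<in> k"
        using a_F[OF x] by (auto simp: k_def)
    qed
    moreover have "im_agree F k ?e"
      unfolding im_agree_def
    proof (intro ballI allI iffI)
      fix y x assume y: "y \<in> F" and "(x, y) \<in> k"
      then obtain z where z: "(x, z) \<in> g" "(y, z) \<in> g"
        using a_F[OF y] by (auto simp: k_def)
      then have "x = y"
        by (rule sym_inv_monoid_left_unique[OF g])
      then show "(x, y) \<in> ?e"
        using z(2) g_F[OF y] by blast
    next
      fix y x assume y: "y \<in> F" and "(x, y) \<in> ?e"
      then obtain z where "x = y" "(y, z) \<in> g"
        using g_F[OF y] by auto
      then show "(x, y) \<in> k"
        using a_F[OF y] by (auto simp: k_def)
    qed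
    ultimately have "k \<in> V"
      by (intro F(2)[OF kM])
    then have "k O a \<in> U0"
      using aV by (rule VV')
    moreover have "k O a = g"
    proof
      show "k O a \<subseteq> g"
      proof
        fix p assume "p \<in> k O a"
        then obtain x y z w where "p = (x, w)" "(x, z) \<in> g" "(y, z) \<in> a" "(y, w) \<in> a"
          by (auto simp: k_def)
        then show "p \<in> g"
          using sym_inv_monoid_right_unique[OF aM, of y z w] by simp
      qed
      show "g \<subseteq> k O a"
      proof
        fix p assume "p \<in> g"
        then obtain x z y where "p = (x, z)" "(x, z) \<in> g" "(y, z) \<in> a"
          using Rga by (cases p) blast
        then show "p \<in> k O a"
          by (auto simp: k_def)
      qed
    qed
    ultimately show ?thesis
      by simp
  qed
  have "g \<in> U"
    if g: "g \<in> sym_inv_monoid" and agree: "dom_agree Y g h"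
      and few: "ecard (B \<inter> Range g - Range h) \<le> m" for g
  proof (rule ccontr)
    assume "g \<notin> U"
    let ?O = "(topspace T - C) \<inter> {a \<in> sym_inv_monoid. dom_agree Y a g}"
    have O: "openin T ?O"
      using C(1) openin_I2[OF openin_I2_dom_agree[OF finY g]] by (intro openin_Int) auto
    have gO: "g \<in> ?O"
      using g \<open>g \<notin> U\<close> C(2) by (auto simp: topspace dom_agree_refl)
    obtain q where q: "q \<subseteq> g" "finite q" "q \<in> ?O"
      using finite_restriction_in_open[OF openin_I4[OF O] gO] by blast
    have "dom_agree Y q h"
      using q(3) agree by (simp add: dom_agree_def)
    moreover have "ecard (B \<inter> Range q - Range h) \<le> m"
      by (rule order_trans[OF ecard_mono few]) (use Range_mono[OF q(1)] in auto)
    ultimately have "q \<in> U0"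
      using q by (intro fin_case) auto
    then show False
      using q(3) U0(3) by auto
  qed
  then show ?thesis
    using finB finY by blast
qed


section \<open>The waning function of an intermediate topology\<close>

text \<open>
  Multiplication by a surjective partial bijection on the left and one that is defined on all
  relevant points on the right takes neighbours of \<open>h'\<close> to neighbours of \<open>h\<close> and does not
  lose points of \<open>Z'\<close> from the image.
\<close>

lemma evades_transfer:
  assumes h: "h \<in> sym_inv_monoid" "finite h" and h': "h' \<in> sym_inv_monoid" "finite h'"
    and rank: "card (Range h) = card (Range h')"
    and Z: "finite Z" "Z \<inter> Range h = {}" and Z': "finite Z'" "Z' \<inter> Range h' = {}"
    and card: "card Z = card Z'"
    and ev: "evades h Z"
  shows "evades h' Z'"
proof -
  obtain \<beta>1 where \<beta>1: "bij_betw \<beta>1 (Range h') (Range h)"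
    using finite_same_card_bij[of "Range h'" "Range h"] rank h(2) h'(2) by (auto simp: finite_Range)
  obtain \<beta>2 where \<beta>2: "bij_betw \<beta>2 Z' Z"
    using finite_same_card_bij[OF Z'(1) Z(1)] card by auto
  define b1 where "b1 = (\<lambda>y. (y, \<beta>1 y)) ` Range h'"
  define b2 where "b2 = (\<lambda>y. (y, \<beta>2 y)) ` Z'"
  define b where "b = b1 \<union> b2"
  have dom_b: "Domain b1 = Range h'" "Domain b2 = Z'"
    by (simp_all only: b1_def b2_def Domain_graph)
  have ran_b: "Range b1 = Range h" "Range b2 = Z"
    using \<beta>1 \<beta>2 by (simp_all only: b1_def b2_def Range_graph bij_betw_imp_surj_on)
  have bM: "b \<in> sym_inv_monoid"
    unfolding b_def
  proof (rule sym_inv_monoid_Un)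
    show "b1 \<in> sym_inv_monoid" "b2 \<in> sym_inv_monoid"
      unfolding b1_def b2_def using \<beta>1 \<beta>2 by (auto intro!: sym_inv_monoid_pairs dest: bij_betw_imp_inj_on)
  qed (use Z Z' in \<open>auto simp only: dom_b ran_b\<close>)
  (* c satisfies c h' b = h; adding a bijection d between the complements of the domains makes it
     surjective without changing this product. *)
  define c where "c = h O b\<inverse> O h'\<inverse>"
  have cM: "c \<in> sym_inv_monoid"
    unfolding c_def by (intro sym_inv_monoid_relcomp sym_inv_monoid_converse h(1) h'(1) bM)
  have c_dom: "Domain c \<subseteq> Domain h" and c_ran: "Range c \<subseteq> Domain h'"
    unfolding c_def by blast+
  have "infinite (- Domain h)" "infinite (- Domain h')"
    using h(2) h'(2) by (simp_all add: finite_Domain finite_compl)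
  then obtain e e' where "bij_betw e (- Domain h) (UNIV :: nat set)" "bij_betw e' (- Domain h') (UNIV :: nat set)"
    by (metis countableE_infinite countableI_type)
  then obtain \<gamma> where \<gamma>: "bij_betw \<gamma> (- Domain h) (- Domain h')"
    using bij_betw_trans bij_betw_inv_into by blast
  define d where "d = (\<lambda>x. (x, \<gamma> x)) ` (- Domain h)"
  have d_dom: "Domain d = - Domain h" and d_ran: "Range d = - Domain h'"
    using bij_betw_imp_surj_on[OF \<gamma>]
    by (simp_all only: d_def Domain_graph Range_graph)
  define a where "a = c \<union> d"
  have aM: "a \<in> sym_inv_monoid"
    unfolding a_def
  proof (rule sym_inv_monoid_Un[OF cM])
    show "d \<in> sym_inv_monoid"
      unfolding d_def using \<gamma> by (intro sym_inv_monoid_pairs) (auto dest: bij_betw_imp_inj_on)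
  qed (use c_dom c_ran d_dom d_ran in blast)+
  have preimage: "\<exists>v w. (v, y) \<in> b \<and> (w, v) \<in> h'" if "y \<in> Range h" for y
  proof -
    obtain v where "(v, y) \<in> b1"
      using \<open>y \<in> Range h\<close> ran_b(1) by blast
    moreover from this have "v \<in> Range h'"
      using dom_b(1) by blast
    ultimately show ?thesis
      unfolding b_def by blast
  qed
  have ranc: "Domain h' \<subseteq> Range c"
  proof
    fix w assume "w \<in> Domain h'"
    then obtain v where v: "(w, v) \<in> h'"
      by blast
    then have "v \<in> Domain b1"
      unfolding dom_b(1) by (rule RangeI)
    then obtain y where y: "(v, y) \<in> b1"
      by blast
    then have "y \<in> Range h"
      using ran_b(1) by blast
    then obtain x where "(x, y) \<in> h"
      by blast
    with v y show "w \<in> Range c"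
      unfolding c_def b_def by blast
  qed
  have ran_a: "Range a = UNIV"
    using ranc d_ran unfolding a_def by (simp add: Range_Un_eq) blast
  have prod: "a O h' O b = h"
  proof
    show "a O h' O b \<subseteq> h"
    proof
      fix p assume "p \<in> a O h' O b"
      then obtain x w v y where p: "p = (x, y)" "(x, w) \<in> a" "(w, v) \<in> h'" "(v, y) \<in> b"
        by auto
      then have "(x, w) \<in> c"
        using d_ran by (auto simp: a_def)
      then obtain y' v' where c: "(x, y') \<in> h" "(v', y') \<in> b" "(w, v') \<in> h'"
        unfolding c_def by blast
      then have "v' = v"
        using sym_inv_monoid_right_unique[OF h'(1)] p(3) by blast
      then have "y' = y"
        using sym_inv_monoid_right_unique[OF bM] c(2) p(4) by blast
      with c(1) p(1) show "p \<in> h"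
        by simp
    qed
    show "h \<subseteq> a O h' O b"
    proof
      fix p assume "p \<in> h"
      then obtain x y where p: "p = (x, y)" "(x, y) \<in> h"
        by (cases p) auto
      then obtain v w where "(v, y) \<in> b" "(w, v) \<in> h'"
        using preimage by blast
      moreover from this p have "(x, w) \<in> a"
        unfolding a_def c_def by blast
      ultimately show "p \<in> a O h' O b"
        using p(1) by blast
    qed
  qed
  obtain V where V: "openin T V" "h \<in> V" "\<And>g. g \<in> V \<Longrightarrow> \<not> Z \<subseteq> Range g"
    using ev by (auto simp: evades_def)
  have "a O (h' O b) \<in> V"
    using V(2) prod by simp
  then obtain A B where AB: "a \<in> A" "openin T B" "h' O b \<in> B"
    "\<And>x y. x \<in> A \<Longrightarrow> y \<in> B \<Longrightarrow> x O y \<in> V"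
    using mult_neighbourhoods[OF V(1) aM sym_inv_monoid_relcomp[OF h'(1) bM]] by metis
  then obtain C D where CD: "openin T C" "h' \<in> C" "b \<in> D"
    "\<And>x y. x \<in> C \<Longrightarrow> y \<in> D \<Longrightarrow> x O y \<in> B"
    using mult_neighbourhoods[OF AB(2) h'(1) bM] by metis
  have "\<not> Z' \<subseteq> Range g" if "g \<in> C" for g
  proof
    assume sub: "Z' \<subseteq> Range g"
    have "Z \<subseteq> Range (a O g O b)"
    proof
      fix z assume "z \<in> Z"
      then obtain v where v: "(v, z) \<in> b2"
        using ran_b(2) by blast
      then have "v \<in> Z'"
        using dom_b(2) by blast
      then obtain w where w: "(w, v) \<in> g"
        using sub by blast
      obtain x where "(x, w) \<in> a"
        using ran_a by blast
      with v w show "z \<in> Range (a O g O b)"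
        unfolding b_def by blast
    qed
    moreover have "a O g O b \<in> V"
      using AB(1,4) CD(3,4) that by blast
    ultimately show False
      using V(3) by blast
  qed
  with CD(1,2) show ?thesis
    unfolding evades_def by blast
qed

text \<open>
  By symmetry it suffices to look at the identity of \<open>{..<n}\<close> in order to find out how many new image points
  the neighbours of a partial bijection of rank \<open>n\<close> can be forbidden to have.  The
  bound is the largest number of new points that cannot be forbidden, which is one less than the least
  size of an evadable set; this size is positive because the empty set cannot be evaded.
\<close>

definition evadable :: "nat \<Rightarrow> nat \<Rightarrow> bool" where
  "evadable n k \<longleftrightarrow> (\<exists>Z. finite Z \<and> card Z = k \<and> Z \<inter> {..<n} = {} \<and> evades (Id_on {..<n}) Z)"

definition image_bound :: "nat \<Rightarrow> enat" where
  "image_bound n = (if \<exists>k. evadable n k then enat ((LEAST k. evadable n k) - 1) else \<infinity>)"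

lemma image_bound_less_iff: "image_bound n < enat j \<longleftrightarrow> (\<exists>k\<le>j. evadable n k)"
proof (cases "\<exists>k. evadable n k")
  case True
  let ?k = "LEAST k. evadable n k"
  have k: "evadable n ?k"
    using True by (rule LeastI_ex)
  have "\<not> evadable n 0"
    by (auto simp: evadable_def not_evades_empty)
  with k have "?k \<noteq> 0"
    by metis
  then have "image_bound n < enat j \<longleftrightarrow> ?k \<le> j"
    using True by (auto simp: image_bound_def)
  also have "\<dots> \<longleftrightarrow> (\<exists>k\<le>j. evadable n k)"
    using k Least_le[of "evadable n"] order_trans by blast
  finally show ?thesis .
qed (auto simp: image_bound_def)

lemma evades_iff:
  assumes h: "h \<in> sym_inv_monoid" "finite h" and Z: "finite Z" "Z \<inter> Range h = {}"
  shows "evades h Z \<longleftrightarrow> image_bound (card (Range h)) < enat (card Z)"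
proof
  let ?n = "card (Range h)"
  assume ev: "evades h Z"
  let ?Z = "{?n..<?n + card Z}"
  have "evades (Id_on {..<?n}) ?Z"
    by (rule evades_transfer[OF h _ _ _ Z _ _ _ ev]) (auto simp: sym_inv_monoid_Id_on finite_Id_on)
  then have "evadable ?n (card Z)"
    unfolding evadable_def by (intro exI[of _ ?Z]) auto
  then show "image_bound ?n < enat (card Z)"
    unfolding image_bound_less_iff by blast
next
  let ?n = "card (Range h)"
  assume "image_bound ?n < enat (card Z)"
  then obtain Z' where Z': "finite Z'" "card Z' \<le> card Z" "Z' \<inter> {..<?n} = {}" "evades (Id_on {..<?n}) Z'"
    unfolding image_bound_less_iff evadable_def by blast
  then obtain S where S: "S \<subseteq> Z" "finite S" "card S = card Z'"
    by (meson obtain_subset_with_card_n)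
  have "evades h S"
    by (rule evades_transfer[OF _ _ h _ Z'(1) _ S(2) _ _ Z'(4)])
      (use S Z Z' in \<open>auto simp: sym_inv_monoid_Id_on finite_Id_on\<close>)
  then show "evades h Z"
    using S(1) by (rule evades_superset)
qed

text \<open>The value at \<open>\<infinity>\<close> is the only one that makes the function waning.\<close>

definition image_bound_fun :: "enat \<Rightarrow> enat" where
  "image_bound_fun i = (case i of enat n \<Rightarrow> image_bound n
     | \<infinity> \<Rightarrow> if \<forall>n. image_bound n = \<infinity> then \<infinity> else 0)"

lemma image_bound_fun_simps [simp]:
  "image_bound_fun (enat n) = image_bound n"
  "image_bound_fun \<infinity> = (if \<forall>n. image_bound n = \<infinity> then \<infinity> else 0)"
  by (simp_all add: image_bound_fun_def)

lemma image_bound_Suc_le: "image_bound (Suc n) \<le> image_bound n"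
proof (cases "image_bound n")
  case (enat m)
  let ?Z = "{Suc n..<Suc n + Suc m}"
  have "evades (Id_on {..<n}) ?Z"
    using enat by (subst evades_iff) (auto simp: sym_inv_monoid_Id_on finite_Id_on)
  then have "evades (Id_on {..<Suc n}) ?Z"
    by (rule evades_extension[rotated -1]) (auto simp: sym_inv_monoid_Id_on)
  then have "image_bound (Suc n) < enat (Suc m)"
    by (subst (asm) evades_iff) (auto simp: sym_inv_monoid_Id_on finite_Id_on)
  then show ?thesis
    using enat by (cases "image_bound (Suc n)") auto
qed simp

text \<open>
  Let \<open>m\<close> be the bound at rank \<open>n\<close>.  The identity of \<open>{..<n}\<close> has a neighbourhood \<open>V\<close> all of whose
  elements miss one of \<open>m + 1\<close> points \<open>n, y\<^sub>1, \<dots>, y\<^sub>m\<close>.  Since one new image point is not restricted,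
  \<open>V\<close> contains a partial bijection of rank \<open>n + 1\<close> whose image has \<open>n\<close> as its only new point, and
  its neighbours in \<open>V\<close> that retain this image point miss one of the \<open>m\<close> points \<open>y\<^sub>1, \<dots>, y\<^sub>m\<close>.
\<close>

lemma image_bound_Suc_less:
  assumes m: "image_bound n = enat m" "m \<noteq> 0"
  shows "image_bound (Suc n) < enat m"
proof -
  let ?h = "Id_on {..<n}"
  let ?Z = "{Suc n..<Suc n + m}"
  have hM: "?h \<in> sym_inv_monoid" and hfin: "finite ?h"
    by (simp_all add: sym_inv_monoid_Id_on finite_Id_on)
  have "evades ?h (insert n ?Z)"
    using m by (subst evades_iff[OF hM hfin]) auto
  then obtain V where V: "openin T V" "?h \<in> V" "\<And>g. g \<in> V \<Longrightarrow> \<not> insert n ?Z \<subseteq> Range g"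
    by (auto simp: evades_def)
  have "\<not> evades ?h Z" if "finite Z" "Z \<inter> Range ?h = {}" "ecard Z \<le> enat m" for Z
    using that m(1) evades_iff[OF hM hfin that(1,2)] by (simp add: ecard_le_iff)
  then obtain X Y where XY: "finite X" "finite Y" "\<And>g. g \<in> sym_inv_monoid \<Longrightarrow> dom_agree Y g ?h \<Longrightarrow>
      ecard (X \<inter> Range g - Range ?h) \<le> enat m \<Longrightarrow> g \<in> V"
    using neighbourhood_of_few_new_image_points[OF V(1,2), of "enat m"] by metis
  have "finite (Y \<union> {..<n})"
    using XY(2) by simp
  then obtain N where N: "\<forall>y \<in> Y \<union> {..<n}. y < N"
    unfolding finite_nat_set_iff_bounded by blast
  let ?g = "insert (N, n) ?h"
  have "?h \<union> {(N, n)} \<in> sym_inv_monoid"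
    by (rule sym_inv_monoid_Un[OF hM]) (use N in \<open>auto simp: sym_inv_monoid_iff\<close>)
  then have gM: "?g \<in> sym_inv_monoid"
    by simp
  have Rg: "Range ?g = {..<Suc n}"
    by auto
  have "?g \<in> V"
  proof (rule XY(3)[OF gM])
    show "dom_agree Y ?g ?h"
      using N by (auto simp: dom_agree_def)
    have "ecard (X \<inter> Range ?g - Range ?h) \<le> ecard {n}"
      by (rule ecard_mono) (auto simp: Rg)
    also have "\<dots> \<le> enat m"
      using m(2) by (simp add: ecard_def)
    finally show "ecard (X \<inter> Range ?g - Range ?h) \<le> enat m" .
  qed
  let ?V = "V \<inter> {a \<in> sym_inv_monoid. {(N, n)} \<subseteq> a}"
  have "openin T ?V"
    by (intro openin_Int V(1) openin_I2[OF openin_I2_extensions]) simp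
  moreover have "?g \<in> ?V"
    using \<open>?g \<in> V\<close> gM by simp
  moreover have "\<not> ?Z \<subseteq> Range a" if "a \<in> ?V" for a
    using V(3)[of a] that by (auto simp del: Range_Id_on)
  ultimately have "evades ?g ?Z"
    unfolding evades_def by blast
  moreover have "?Z \<inter> Range ?g = {}"
    unfolding Rg by auto
  ultimately have "image_bound (card (Range ?g)) < enat (card ?Z)"
    using evades_iff[OF gM, of ?Z] hfin by blast
  then show ?thesis
    unfolding Rg by simp
qed

lemma waning_image_bound_fun: "waning image_bound_fun"
  unfolding waning_def
proof
  show "antimono image_bound_fun"
  proof (rule antimonoI)
    fix i j :: enat assume "i \<le> j"
    have "image_bound b \<le> image_bound a" if "a \<le> b" for a b
      using that by (induction rule: dec_induct) (auto intro: order_trans image_bound_Suc_le)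
    then show "image_bound_fun j \<le> image_bound_fun i"
      using \<open>i \<le> j\<close> by (cases i; cases j) auto
  qed
  show "(\<forall>i. image_bound_fun i = \<infinity>) \<or> (\<exists>i. image_bound_fun (enat i) \<noteq> \<infinity>) \<and>
    (\<forall>j. image_bound_fun (enat j) \<noteq> 0 \<and> image_bound_fun (enat j) \<noteq> \<infinity> \<longrightarrow>
      image_bound_fun (enat (j + 1)) < image_bound_fun (enat j))"
  proof (cases "\<forall>n. image_bound n = \<infinity>")
    case True
    then have "image_bound_fun i = \<infinity>" for i
      by (cases i) auto
    then show ?thesis
      by simp
  next
    case False
    then show ?thesis
      using image_bound_Suc_less by (auto simp: zero_enat_def)
  qed
qed

text \<open>
  Let \<open>m\<close> be the bound at rank \<open>n\<close> and let \<open>c \<le> m\<close> points of \<open>X\<close> lie in the image of \<open>h\<close>.  A restriction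
  \<open>q\<close> of \<open>h\<close> of rank \<open>n + c\<close> evades every set of \<open>m - c + 1\<close> points outside the image of \<open>h\<close>,
  as the bound at rank \<open>n + c\<close> is at most \<open>m - c\<close>; hence so does \<open>h\<close>.  Evading the finitely many such subsets
  of \<open>X\<close> at once means that at most \<open>m - c\<close> new points of \<open>X\<close> enter the image.
\<close>

lemma T_fun_image_bound_fun_le: "topology_le (T_fun image_bound_fun) T"
  unfolding T_fun_def
proof (rule topology_generated_by_le)
  fix S assume "S \<in> Collect (openin I2) \<union> {U_fun_set image_bound_fun n X |n X. finite X}"
  then consider "openin I2 S" | n X where "S = U_fun_set image_bound_fun n X" "finite X"
    by blast
  then show "openin T S"
  proof cases
    case 2
    show ?thesis
    proof (cases "image_bound n")
      case infinity
      then show ?thesis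
        using openin_I2_large_range by (simp add: 2 U_fun_set_eq_infinity openin_I2)
    next
      case (enat m)
      show ?thesis
      proof (subst openin_subopen, intro ballI)
        fix h assume "h \<in> S"
        then have h: "h \<in> sym_inv_monoid" "enat n \<le> ecard (Range h - X)" "ecard (X \<inter> Range h) \<le> enat m"
          using enat by (auto simp: 2 U_fun_set_def)
        define c where "c = card (X \<inter> Range h)"
        have c: "c \<le> m"
          using h(3) by (simp add: c_def ecard_le_iff)
        have bound: "image_bound (n + c) \<le> enat (m - c)"
          using waning_drop[OF waning_image_bound_fun, of n m c] enat by auto
        obtain B where B: "B \<subseteq> Range h - X" "finite B" "card B = n"
          using h(2) by (auto simp: enat_le_ecard_iff)
        obtain q where q: "q \<subseteq> h" "finite q" "Range q = B \<union> (X \<inter> Range h)"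
          using exists_restriction_with_range[OF h(1), of "B \<union> (X \<inter> Range h)"] B(1,2) 2(2) by blast
        have qM: "q \<in> sym_inv_monoid"
          using h(1) q(1) by (rule sym_inv_monoid_subset)
        have rank: "card (Range q) = n + c"
          unfolding q(3) c_def using B 2(2) by (subst card_Un_disjoint) auto
        define \<Z> where "\<Z> = {Z. Z \<subseteq> X - Range h \<and> card Z = Suc (m - c)}"
        have fin\<Z>: "finite \<Z>"
          by (rule finite_subset[of _ "Pow X"]) (use 2(2) in \<open>auto simp: \<Z>_def\<close>)
        have "evades h Z" if "Z \<in> \<Z>" for Z
        proof (rule evades_extension[OF h(1) q(1)])
          show "Z \<inter> Range h = {}"
            using that by (auto simp: \<Z>_def)
          have "finite Z" "Z \<inter> Range q = {}"
            using that 2(2) B Range_mono[OF q(1)] by (auto simp: \<Z>_def intro: finite_subset)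
          moreover have "image_bound (card (Range q)) < enat (card Z)"
            using order_le_less_trans[OF bound, of "enat (Suc (m - c))"] that by (simp add: rank \<Z>_def)
          ultimately show "evades q Z"
            using evades_iff[OF qM q(2)] by blast
        qed
        then obtain V where V: "\<And>Z. Z \<in> \<Z> \<Longrightarrow> openin T (V Z) \<and> h \<in> V Z \<and> (\<forall>g\<in>V Z. \<not> Z \<subseteq> Range g)"
          unfolding evades_def by metis
        let ?E = "{g \<in> sym_inv_monoid. q \<subseteq> g}"
        let ?V = "\<Inter> (insert ?E (V ` \<Z>))"
        have "openin T ?V"
          using V fin\<Z> openin_I2[OF openin_I2_extensions[OF q(2)]] by (intro openin_Inter) auto
        moreover have "h \<in> ?V"
          using V h(1) q(1) by auto
        moreover have "?V \<subseteq> S"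
        proof
          fix g assume g: "g \<in> ?V"
          then have Rqg: "Range q \<subseteq> Range g" and gM: "g \<in> sym_inv_monoid"
            using Range_mono by auto
          have "B \<subseteq> Range g - X"
            using B Rqg q(3) by auto
          then have "enat n \<le> ecard (Range g - X)"
            using B by (auto simp: enat_le_ecard_iff)
          moreover have "card (X \<inter> Range g) \<le> m"
          proof (rule ccontr)
            assume "\<not> card (X \<inter> Range g) \<le> m"
            moreover have "card (X \<inter> Range g) \<le> card ((X \<inter> Range h) \<union> ((X - Range h) \<inter> Range g))"
              using 2(2) by (intro card_mono) auto
            moreover have "\<dots> \<le> c + card ((X - Range h) \<inter> Range g)"
              unfolding c_def by (rule card_Un_le)
            ultimately have "Suc (m - c) \<le> card ((X - Range h) \<inter> Range g)"
              using c by linarith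
            then obtain Z where "Z \<subseteq> (X - Range h) \<inter> Range g" "card Z = Suc (m - c)"
              by (meson obtain_subset_with_card_n)
            then have "Z \<in> \<Z>" "Z \<subseteq> Range g"
              by (auto simp: \<Z>_def)
            then show False
              using V g by blast
          qed
          ultimately show "g \<in> S"
            using gM 2(2) enat by (simp add: 2(1) U_fun_set_def ecard_le_iff)
        qed
        ultimately show "\<exists>V. openin T V \<and> h \<in> V \<and> V \<subseteq> S"
          by blast
      qed
    qed
  qed (rule openin_I2)
qed

text \<open>
  For finite rank this is the meaning of the bound.  If \<open>h\<close> has infinite rank and the bounds
  are all infinite, then \<open>h\<close> evades nothing, because finite restrictions of \<open>h\<close> are close to \<open>h\<close>
  and would evade the same set; if some bound is finite, then only the empty set is to be considered.
\<close>

lemma not_evades_bounded: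
  assumes h: "h \<in> sym_inv_monoid" and Z: "finite Z" "Z \<inter> Range h = {}"
    and le: "ecard Z \<le> image_bound_fun (ecard (Range h))"
  shows "\<not> evades h Z"
proof (cases "finite h")
  case True
  then show ?thesis
    using le evades_iff[OF h True Z] by (simp add: ecard_finite finite_Range Z(1) not_less)
next
  case False
  then have inf: "ecard (Range h) = \<infinity>"
    using finite_partial_bijection_iff[OF h] by (simp add: ecard_def)
  show ?thesis
  proof (cases "\<forall>n. image_bound n = \<infinity>")
    case True
    show ?thesis
    proof
      assume "evades h Z"
      then obtain q where q: "q \<subseteq> h" "finite q" "evades q Z"
        by (rule evades_finite_restriction)
      then have "image_bound (card (Range q)) < enat (card Z)"
        using evades_iff[OF sym_inv_monoid_subset[OF h q(1)] q(2) Z(1)] Range_mono[OF q(1)] Z(2) by blast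
      with True show False
        by simp
    qed
  next
    case False
    then have "ecard Z \<le> enat 0"
      using le unfolding inf by (simp add: zero_enat_def split: if_splits)
    then have "Z = {}"
      using Z(1) by (simp add: ecard_le_iff)
    then show ?thesis
      by (simp add: not_evades_empty)
  qed
qed

text \<open>
  By the description of neighbourhoods above, an open set around \<open>h\<close> contains all \<open>g\<close> that are \<open>\<I>\<^sub>2\<close>-close
  to \<open>h\<close> and have no more new image points in some finite set \<open>X\<close> than the bound for the rank of \<open>h\<close> allows.
  The latter condition is that of a generator of the topology of the bound function, with \<open>X\<close>
  reduced to the points outside the image of \<open>h\<close>.
\<close>

lemma le_T_fun_image_bound_fun: "topology_le T (T_fun image_bound_fun)"
  unfolding topology_le_iff
proof (intro allI impI)
  let ?f = image_bound_fun
  fix U assume U: "openin T U"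
  show "openin (T_fun ?f) U"
  proof (subst openin_subopen, intro ballI)
    fix h assume hU: "h \<in> U"
    then have h: "h \<in> sym_inv_monoid"
      using openin_subset[OF U] by (auto simp: topspace)
    (* A generator has a finite parameter; for infinite rank one is chosen at which the function
       has already reached its value at infinity. *)
    obtain n where n: "enat n \<le> ecard (Range h)" "?f (enat n) = ?f (ecard (Range h))"
    proof (cases "ecard (Range h)")
      case (enat n)
      then show ?thesis
        using that[of n] by simp
    next
      case infinity
      from waning_infinity[OF waning_image_bound_fun] obtain n where "?f (enat n) = ?f \<infinity>"
        by metis
      then show ?thesis
        using that[of n] infinity by simp
    qed
    obtain X Y where XY: "finite X" "finite Y" "\<And>g. g \<in> sym_inv_monoid \<Longrightarrow> dom_agree Y g h \<Longrightarrow>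
        ecard (X \<inter> Range g - Range h) \<le> ?f (ecard (Range h)) \<Longrightarrow> g \<in> U"
      using neighbourhood_of_few_new_image_points[OF U hU, of "?f (ecard (Range h))"]
        not_evades_bounded[OF h] by metis
    let ?X = "X - Range h"
    let ?V = "U_fun_set ?f n ?X \<inter> {g \<in> sym_inv_monoid. dom_agree Y g h}"
    have "openin (T_fun ?f) ?V"
      using XY(1) openin_I2_dom_agree[OF XY(2) h] topology_le_I2_T_fun
      by (intro openin_Int openin_T_fun_U_fun_set) (auto simp: topology_le_iff)
    moreover have "h \<in> ?V"
    proof -
      have "Range h - ?X = Range h" "?X \<inter> Range h = {}"
        by auto
      then show ?thesis
        using h n(1) by (simp add: U_fun_set_def dom_agree_refl ecard_finite[of "{}"] zero_enat_def[symmetric])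
    qed
    moreover have "?V \<subseteq> U"
    proof
      fix g assume g: "g \<in> ?V"
      have "?X \<inter> Range g = X \<inter> Range g - Range h"
        by auto
      with g n(2) show "g \<in> U"
        by (intro XY(3)) (auto simp: U_fun_set_def)
    qed
    ultimately show "\<exists>V. openin (T_fun ?f) V \<and> h \<in> V \<and> V \<subseteq> U"
      by blast
  qed
qed

lemma eq_T_fun: "\<exists>f. waning f \<and> T = T_fun f"
  using waning_image_bound_fun topology_le_antisym[OF le_T_fun_image_bound_fun T_fun_image_bound_fun_le]
  by blast

end

lemma order_isomorphism_T_fun:
  "order_isomorphism {f. waning f} waning_le
     {T \<in> Polish_semigroup_topologies. topology_le I2 T \<and> topology_le T I4} topology_le T_fun"
  unfolding order_isomorphism_def bij_betw_def
proof (intro conjI ballI)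
  show "T_fun ` {f. waning f} = {T \<in> Polish_semigroup_topologies. topology_le I2 T \<and> topology_le T I4}"
  proof
    show "T_fun ` {f. waning f} \<subseteq> {T \<in> Polish_semigroup_topologies. topology_le I2 T \<and> topology_le T I4}"
      by (auto simp: Polish_semigroup_topologies_def Polish_space_T_fun semigroup_topology_T_fun
          topology_le_I2_T_fun topology_le_T_fun_I4)
    show "{T \<in> Polish_semigroup_topologies. topology_le I2 T \<and> topology_le T I4} \<subseteq> T_fun ` {f. waning f}"
    proof
      fix T assume T: "T \<in> {T \<in> Polish_semigroup_topologies. topology_le I2 T \<and> topology_le T I4}"
      have "regular_space T"
        using T by (auto simp: Polish_semigroup_topologies_def Polish_space_def
            intro: metrizable_imp_regular_space completely_metrizable_imp_metrizable_space)
      with T interpret intermediate_topology T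
        by unfold_locales (auto simp: Polish_semigroup_topologies_def)
      show "T \<in> T_fun ` {f. waning f}"
        using eq_T_fun by blast
    qed
  qed
qed (auto simp: inj_on_T_fun T_fun_le_iff)


section \<open>Inverting topologies\<close>

lemma converse_image_converse_image [simp]: "converse ` converse ` U = U"
  by (simp add: image_image)

text \<open>
  Taking converses is an involutive anti-automorphism of the monoid.  It turns the given
  topology into the inverse one and exchanges \<open>\<I>\<^sub>2\<close> with \<open>\<I>\<^sub>3\<close>, so the second
  isomorphism is the first one followed by inversion.
\<close>

lemma openin_inverse_topology_iff: "openin (inverse_topology T) V \<longleftrightarrow> openin T (converse ` V)"
  unfolding openin_inverse_topology by (metis converse_image_converse_image)

lemma inverse_topology_inverse_topology: "inverse_topology (inverse_topology T) = T"
  by (simp add: topology_eq openin_inverse_topology_iff)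

lemma topspace_inverse_topology: "topspace (inverse_topology T) = converse ` topspace T"
proof
  have "openin T (converse ` topspace (inverse_topology T))"
    using openin_topspace[of "inverse_topology T"] unfolding openin_inverse_topology_iff .
  then have "converse ` converse ` topspace (inverse_topology T) \<subseteq> converse ` topspace T"
    by (intro image_mono openin_subset)
  then show "topspace (inverse_topology T) \<subseteq> converse ` topspace T"
    by simp
  show "converse ` topspace T \<subseteq> topspace (inverse_topology T)"
    by (rule openin_subset) (simp add: openin_inverse_topology_iff)
qed

lemma topology_le_inverse_topology:
  "topology_le (inverse_topology S) (inverse_topology T) \<longleftrightarrow> topology_le S T"
  unfolding topology_le_iff openin_inverse_topology_iff by (metis converse_image_converse_image)

lemma converse_image_sym_inv_monoid: "converse ` sym_inv_monoid = sym_inv_monoid"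
proof
  show "converse ` sym_inv_monoid \<subseteq> sym_inv_monoid"
    by (auto simp: sym_inv_monoid_converse)
  then show "sym_inv_monoid \<subseteq> converse ` sym_inv_monoid"
    by (metis converse_image_converse_image image_mono)
qed

lemma mem_converse_image_iff: "g \<in> converse ` S \<longleftrightarrow> g\<inverse> \<in> S"
  by (metis converse_converse image_iff)

lemma converse_image_generators:
  "converse ` U_set x y = U_set y x" "converse ` W_set x = W_inv_set x" "converse ` W_inv_set x = W_set x"
proof -
  have "g\<inverse> \<in> sym_inv_monoid \<longleftrightarrow> g \<in> sym_inv_monoid" for g
    using sym_inv_monoid_converse by (metis converse_converse)
  then show "converse ` U_set x y = U_set y x" "converse ` W_set x = W_inv_set x"
    "converse ` W_inv_set x = W_set x"
    by (auto simp: set_eq_iff mem_converse_image_iff U_set_def W_set_def W_inv_set_def)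
qed

lemma topology_le_inverse_generated_by:
  assumes "\<And>S. S \<in> \<S> \<Longrightarrow> openin T (converse ` S)"
  shows "topology_le (topology_generated_by \<S>) (inverse_topology T)"
  by (rule topology_generated_by_le) (simp add: openin_inverse_topology_iff assms)

lemma topology_le_inverse_swap: "topology_le (inverse_topology S) T \<longleftrightarrow> topology_le S (inverse_topology T)"
  by (metis inverse_topology_inverse_topology topology_le_inverse_topology)

lemma inverse_topology_I2: "inverse_topology I2 = I3"
proof (rule topology_le_antisym)
  have I3: "openin I3 (U_set x y)" "openin I3 (W_inv_set x)" for x y
    unfolding I3_def by (rule topology_generated_by_Basis; blast)+
  have I2: "openin I2 (U_set x y)" "openin I2 (W_set x)" for x y
    unfolding I2_def by (rule topology_generated_by_Basis; blast)+
  show "topology_le (inverse_topology I2) I3"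
    unfolding topology_le_inverse_swap unfolding I2_def
    by (rule topology_le_inverse_generated_by) (auto simp: converse_image_generators I3)
  show "topology_le I3 (inverse_topology I2)"
    unfolding I3_def
    by (rule topology_le_inverse_generated_by) (auto simp: converse_image_generators I2)
qed

lemma inverse_topology_I3: "inverse_topology I3 = I2"
  using inverse_topology_inverse_topology[of I2] by (simp add: inverse_topology_I2)

lemma inverse_topology_I4: "inverse_topology I4 = I4"
proof (rule topology_le_antisym)
  have "openin I4 (converse ` S)" if "openin I2 S \<or> openin I3 S" for S
  proof -
    have "openin I3 (converse ` S) \<or> openin I2 (converse ` S)"
      using that by (simp add: openin_inverse_topology_iff[symmetric] inverse_topology_I2 inverse_topology_I3)
    then show ?thesis
      using topology_le_I2_I4 topology_le_I3_I4 by (auto simp: topology_le_iff)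
  qed
  then show le: "topology_le I4 (inverse_topology I4)"
    unfolding I4_def by (intro topology_le_inverse_generated_by) (auto simp: I4_def[symmetric])
  then show "topology_le (inverse_topology I4) I4"
    unfolding topology_le_inverse_swap .
qed

lemma continuous_map_converse: "continuous_map (inverse_topology T) T converse"
proof -
  have "{g \<in> topspace (inverse_topology T). g\<inverse> \<in> U} = converse ` U" if "openin T U" for U
    using openin_subset[OF that] by (auto simp: topspace_inverse_topology mem_converse_image_iff)
  then show ?thesis
    by (auto simp: continuous_map_def openin_inverse_topology_iff topspace_inverse_topology)
qed

lemma homeomorphic_inverse_topology: "inverse_topology T homeomorphic_space T"
proof -
  have "homeomorphic_maps (inverse_topology T) T converse converse"
    using continuous_map_converse[of T] continuous_map_converse[of "inverse_topology T"]
    by (simp add: homeomorphic_maps_def inverse_topology_inverse_topology)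
  then show ?thesis
    unfolding homeomorphic_space_def by blast
qed

lemma Polish_space_inverse_topology:
  assumes "Polish_space T"
  shows "Polish_space (inverse_topology T)"
  unfolding Polish_space_def
proof
  show "completely_metrizable_space (inverse_topology T)"
    using assms homeomorphic_completely_metrizable_space[OF homeomorphic_inverse_topology]
    by (auto simp: Polish_space_def)
  obtain C where C: "countable C" "C \<subseteq> topspace T" "T closure_of C = topspace T"
    using assms by (auto simp: Polish_space_def separable_space_def)
  have "g \<in> inverse_topology T closure_of (converse ` C)" if g: "g \<in> topspace (inverse_topology T)" for g
    unfolding in_closure_of
  proof (intro conjI allI impI g)
    fix U assume U: "g \<in> U \<and> openin (inverse_topology T) U"
    have "g\<inverse> \<in> T closure_of C"
      unfolding C(3) using g by (simp add: topspace_inverse_topology mem_converse_image_iff)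
    moreover have "g\<inverse> \<in> converse ` U" "openin T (converse ` U)"
      using U by (simp_all add: openin_inverse_topology_iff)
    ultimately obtain c where "c \<in> C" "c \<in> converse ` U"
      unfolding in_closure_of by blast
    then show "\<exists>y. y \<in> converse ` C \<and> y \<in> U"
      by (metis imageI mem_converse_image_iff)
  qed
  then have "inverse_topology T closure_of (converse ` C) = topspace (inverse_topology T)"
    using closure_of_subset_topspace[of "inverse_topology T"] by blast
  then show "separable_space (inverse_topology T)"
    unfolding separable_space_def using C
    by (intro exI[of _ "converse ` C"]) (auto simp: topspace_inverse_topology)
qed

lemma semigroup_topology_inverse_topology:
  assumes "semigroup_topology T"
  shows "semigroup_topology (inverse_topology T)"
  unfolding semigroup_topology_def
proof
  let ?I = "inverse_topology T"
  show "topspace ?I = sym_inv_monoid"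
    using assms by (simp add: semigroup_topology_def topspace_inverse_topology converse_image_sym_inv_monoid)
  have "continuous_map (prod_topology ?I ?I) (prod_topology T T) (\<lambda>p. ((snd p)\<inverse>, (fst p)\<inverse>))"
    by (intro continuous_map_pairedI continuous_map_compose[OF _ continuous_map_converse, unfolded o_def]
        continuous_map_fst continuous_map_snd)
  moreover have "continuous_map (prod_topology T T) T (\<lambda>(f, g). f O g)"
    using assms by (simp add: semigroup_topology_def)
  ultimately have "continuous_map (prod_topology ?I ?I) T (\<lambda>p. (snd p)\<inverse> O (fst p)\<inverse>)"
    by (auto dest: continuous_map_compose simp: o_def)
  moreover have "continuous_map T ?I converse"
    using continuous_map_converse[of ?I] by (simp add: inverse_topology_inverse_topology)
  ultimately have "continuous_map (prod_topology ?I ?I) ?I (\<lambda>p. ((snd p)\<inverse> O (fst p)\<inverse>)\<inverse>)"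
    by (auto dest: continuous_map_compose simp: o_def)
  then show "continuous_map (prod_topology ?I ?I) ?I (\<lambda>(f, g). f O g)"
    by (simp add: converse_relcomp case_prod_unfold)
qed

lemma inverse_topology_image_interval:
  "inverse_topology ` {T \<in> Polish_semigroup_topologies. topology_le I2 T \<and> topology_le T I4} =
     {T \<in> Polish_semigroup_topologies. topology_le I3 T \<and> topology_le T I4}"
proof -
  have P: "inverse_topology T \<in> Polish_semigroup_topologies" if "T \<in> Polish_semigroup_topologies" for T
    using that by (simp add: Polish_semigroup_topologies_def Polish_space_inverse_topology
        semigroup_topology_inverse_topology)
  have le: "topology_le I3 (inverse_topology T) \<longleftrightarrow> topology_le I2 T"
    "topology_le I2 (inverse_topology T) \<longleftrightarrow> topology_le I3 T"
    "topology_le (inverse_topology T) I4 \<longleftrightarrow> topology_le T I4" for T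
    using topology_le_inverse_topology[of I2 T] topology_le_inverse_topology[of I3 T]
      topology_le_inverse_topology[of T I4]
    by (simp_all add: inverse_topology_I2 inverse_topology_I3 inverse_topology_I4)
  show ?thesis
  proof
    show "inverse_topology ` {T \<in> Polish_semigroup_topologies. topology_le I2 T \<and> topology_le T I4} \<subseteq>
        {T \<in> Polish_semigroup_topologies. topology_le I3 T \<and> topology_le T I4}"
      using P le by auto
    show "{T \<in> Polish_semigroup_topologies. topology_le I3 T \<and> topology_le T I4} \<subseteq>
        inverse_topology ` {T \<in> Polish_semigroup_topologies. topology_le I2 T \<and> topology_le T I4}"
    proof
      fix T assume "T \<in> {T \<in> Polish_semigroup_topologies. topology_le I3 T \<and> topology_le T I4}"
      then have "inverse_topology T \<in> {T \<in> Polish_semigroup_topologies. topology_le I2 T \<and> topology_le T I4}"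
        using P le by auto
      then show "T \<in> inverse_topology ` {T \<in> Polish_semigroup_topologies. topology_le I2 T \<and> topology_le T I4}"
        by (rule rev_image_eqI) (simp add: inverse_topology_inverse_topology)
    qed
  qed
qed

theorem theorem2p6:
  shows "order_isomorphism {f. waning f} waning_le
           {T \<in> Polish_semigroup_topologies. topology_le I2 T \<and> topology_le T I4} topology_le
           (\<lambda>f. T_fun f)
       \<and> order_isomorphism {f. waning f} waning_le
           {T \<in> Polish_semigroup_topologies. topology_le I3 T \<and> topology_le T I4} topology_le
           (\<lambda>f. inverse_topology (T_fun f))"
proof
  let ?A = "{T \<in> Polish_semigroup_topologies. topology_le I2 T \<and> topology_le T I4}"
  let ?B = "{T \<in> Polish_semigroup_topologies. topology_le I3 T \<and> topology_le T I4}"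
  show iso: "order_isomorphism {f. waning f} waning_le ?A topology_le (\<lambda>f. T_fun f)"
    by (rule order_isomorphism_T_fun)
  have "inj_on inverse_topology ?A"
    by (rule inj_on_inverseI[of _ inverse_topology]) (rule inverse_topology_inverse_topology)
  then have "bij_betw inverse_topology ?A ?B"
    by (simp add: bij_betw_def inverse_topology_image_interval)
  with iso show "order_isomorphism {f. waning f} waning_le ?B topology_le (\<lambda>f. inverse_topology (T_fun f))"
    unfolding order_isomorphism_def
    by (auto simp: topology_le_inverse_topology dest: bij_betw_trans simp: o_def)
qed

end
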